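(* Let $H$ be a fixed connected simple undirected graph with vertex set $[k]$, and let $\mathit{td}(H)$ denote its treedepth. For $n\ge1$, let $\mathrm{Hom}_{H,n}$ be the homomorphism polynomial of $H$ (defined in the context). Then the minimum size of a monotone arithmetic formula computing $\mathrm{Hom}_{H,n}$ is $\Theta\bigl(n^{\mathit{td}(H)}\bigr)$ as $n\to\infty$, where the constants hidden in $\Theta$ may depend on $H$.
   Context: A homomorphism from $H$ to $G$ is a map $\phi:V(H)\to V(G)$ with $\{i,j\}\in E(H)\Rightarrow\{\phi(i),\phi(j)\}\in E(G)$; write $\phi(\{i,j\})=\{\phi(i),\phi(j)\}$. The homomorphism polynomial is $\mathrm{Hom}_{H,n}=\sum_{\phi}\prod_{e\in E(H)}x_{\phi(e)}$ over $\mathbb{Q}$ in the variables $x_{\{u,v\}}$ ($u\ne v\in[n]$), where $\phi$ ranges over all homomorphisms from $H$ to $K_n$. An arithmetic circuit is a rooted DAG whose sources are labeled by variables or constants in $\mathbb{Q}$ and whose other nodes are $+$ or $\times$ gates; it is a formula if every gate has out-degree at most one; it is monotone if all constants are non-negative; its size is its number of edges. For a connected graph $H$, an elimination tree is a rooted tree built by choosing a vertex $u$ of $H$ as root and attaching as children the roots of elimination trees of the connected components of $H-u$ (a single vertex graph has the one-vertex tree). Its depth is the number of vertices on a longest leaf-to-root path, and $\mathit{td}(H)$ is the minimum depth of an elimination tree of $H$.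
   Formalization: The graph H is required to have at least two vertices (k ≥ 2): for the single-vertex graph Hom is the constant n, computed by a one-node formula with no edges, so the claimed Θ(n) fails there. *)

theory Defs
  imports Complex_Main "HOL-Library.FuncSet" "HOL-Library.FSet" "HOL-Library.Poly_Mapping"
    "HOL-Library.Landau_Symbols"
begin

section \<open>Simple graphs\<close>

definition simple_graph :: "'a set \<Rightarrow> 'a set set \<Rightarrow> bool" where
  "simple_graph V E \<longleftrightarrow> finite V \<and> (\<forall>e\<in>E. e \<subseteq> V \<and> card e = 2)"

text \<open>In the notions below, a set \<open>S\<close> of vertices together with the edge set \<open>E\<close> of an ambient
  graph stands for the subgraph induced on \<open>S\<close>; edges leaving \<open>S\<close> are ignored.\<close>

definition adj :: "'a set \<Rightarrow> 'a set set \<Rightarrow> ('a \<times> 'a) set" where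
  "adj S E = {(u, v). u \<in> S \<and> v \<in> S \<and> {u, v} \<in> E}"

definition connected_graph :: "'a set \<Rightarrow> 'a set set \<Rightarrow> bool" where
  "connected_graph S E \<longleftrightarrow> S \<noteq> {} \<and> (\<forall>u\<in>S. \<forall>v\<in>S. (u, v) \<in> (adj S E)\<^sup>*)"

definition graph_components :: "'a set \<Rightarrow> 'a set set \<Rightarrow> 'a set set" where
  "graph_components S E = (\<lambda>u. {v. (u, v) \<in> (adj S E)\<^sup>*}) ` S"

definition complete_edges :: "nat \<Rightarrow> nat set set" where
  "complete_edges n = {{u, v} | u v. u \<in> {1..n} \<and> v \<in> {1..n} \<and> u \<noteq> v}"

section \<open>Treedepth\<close>

datatype 'a rtree = Node 'a "'a rtree fset"

primrec depth :: "'a rtree \<Rightarrow> nat" where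
  "depth (Node u ts) = Suc (Max (insert 0 (fset (depth |`| ts))))"

inductive elimination_tree :: "'a set set \<Rightarrow> 'a set \<Rightarrow> 'a rtree \<Rightarrow> bool" for E where
  "\<lbrakk>u \<in> S; fset ts = T ` graph_components (S - {u}) E;
    \<And>C. C \<in> graph_components (S - {u}) E \<Longrightarrow> elimination_tree E C (T C)\<rbrakk>
   \<Longrightarrow> elimination_tree E S (Node u ts)"

definition treedepth :: "'a set \<Rightarrow> 'a set set \<Rightarrow> nat" where
  "treedepth V E = (LEAST d. \<exists>t. elimination_tree E V t \<and> depth t = d)"

section \<open>Homomorphism polynomials\<close>

type_synonym 'x mpoly = "('x \<Rightarrow>\<^sub>0 nat) \<Rightarrow>\<^sub>0 rat"

definition var_poly :: "'x \<Rightarrow> 'x mpoly" where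
  "var_poly x = Poly_Mapping.single (Poly_Mapping.single x 1) 1"

definition const_poly :: "rat \<Rightarrow> 'x mpoly" where
  "const_poly c = Poly_Mapping.single 0 c"

text \<open>Homomorphisms are taken as extensional functions, so that each map \<open>V \<rightarrow> W\<close> is counted once.\<close>

definition graph_homs :: "'a set \<Rightarrow> 'a set set \<Rightarrow> 'b set \<Rightarrow> 'b set set \<Rightarrow> ('a \<Rightarrow> 'b) set" where
  "graph_homs V E W F =
     {\<phi> \<in> V \<rightarrow>\<^sub>E W. \<forall>i j. {i, j} \<in> E \<longrightarrow> {\<phi> i, \<phi> j} \<in> F}"

text \<open>The variable \<open>x\<^bsub>{u,v}\<^esub>\<close> is indexed by the set \<open>{u, v}\<close>.\<close>

definition hom_poly :: "'a set \<Rightarrow> 'a set set \<Rightarrow> nat \<Rightarrow> nat set mpoly" where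
  "hom_poly V E n =
     (\<Sum>\<phi>\<in>graph_homs V E {1..n} (complete_edges n). \<Prod>e\<in>E. var_poly (\<phi> ` e))"

section \<open>Arithmetic circuits\<close>

datatype 'x label = Var 'x | Const rat | Plus | Times

text \<open>Edges point towards the root (the output). Parallel edges are not modelled: they are
  immaterial for formulas, where a gate has at most one outgoing edge and sources with the same
  label may be repeated.\<close>

record 'x circuit =
  nodes :: "nat set"
  edges :: "(nat \<times> nat) set"
  label_of :: "nat \<Rightarrow> 'x label"
  root :: nat

definition preds :: "'x circuit \<Rightarrow> nat \<Rightarrow> nat set" where
  "preds C v = {u. (u, v) \<in> edges C}"

definition succs :: "'x circuit \<Rightarrow> nat \<Rightarrow> nat set" where
  "succs C v = {w. (v, w) \<in> edges C}"

definition arithmetic_circuit :: "'x set \<Rightarrow> 'x circuit \<Rightarrow> bool" where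
  "arithmetic_circuit X C \<longleftrightarrow>
     finite (nodes C) \<and> edges C \<subseteq> nodes C \<times> nodes C \<and> acyclic (edges C) \<and>
     root C \<in> nodes C \<and> (\<forall>v\<in>nodes C. (v, root C) \<in> (edges C)\<^sup>*) \<and>
     (\<forall>v\<in>nodes C. if preds C v = {}
        then label_of C v \<in> Var ` X \<union> range Const
        else label_of C v \<in> {Plus, Times})"

definition arithmetic_formula :: "'x set \<Rightarrow> 'x circuit \<Rightarrow> bool" where
  "arithmetic_formula X C \<longleftrightarrow> arithmetic_circuit X C \<and>
     (\<forall>v\<in>nodes C. label_of C v \<in> {Plus, Times} \<longrightarrow> card (succs C v) \<le> 1)"

definition monotone_circuit :: "'x circuit \<Rightarrow> bool" where
  "monotone_circuit C \<longleftrightarrow> (\<forall>v\<in>nodes C. \<forall>c. label_of C v = Const c \<longrightarrow> 0 \<le> c)"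

definition circuit_size :: "'x circuit \<Rightarrow> nat" where
  "circuit_size C = card (edges C)"

inductive node_computes :: "'x circuit \<Rightarrow> nat \<Rightarrow> 'x mpoly \<Rightarrow> bool" for C where
  "label_of C v = Var x \<Longrightarrow> node_computes C v (var_poly x)"
| "label_of C v = Const c \<Longrightarrow> node_computes C v (const_poly c)"
| "\<lbrakk>label_of C v = Plus; \<And>u. u \<in> preds C v \<Longrightarrow> node_computes C u (f u)\<rbrakk>
   \<Longrightarrow> node_computes C v (\<Sum>u\<in>preds C v. f u)"
| "\<lbrakk>label_of C v = Times; \<And>u. u \<in> preds C v \<Longrightarrow> node_computes C u (f u)\<rbrakk>
   \<Longrightarrow> node_computes C v (\<Prod>u\<in>preds C v. f u)"

lemma node_computes_unique:
  "node_computes C v p \<Longrightarrow> node_computes C v q \<Longrightarrow> p = q"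
proof (induction arbitrary: q rule: node_computes.induct)
  case (3 v f)
  from "3.prems" "3.hyps" show ?case
    by cases (auto intro!: sum.cong "3.IH")
next
  case (4 v f)
  from "4.prems" "4.hyps" show ?case
    by cases (auto intro!: prod.cong "4.IH")
qed (auto elim: node_computes.cases)

lemma node_computes_exists:
  assumes "arithmetic_circuit X C" "v \<in> nodes C"
  shows "\<exists>p. node_computes C v p"
proof -
  have "finite (edges C)" "acyclic (edges C)"
    using assms(1) finite_subset[of "edges C" "nodes C \<times> nodes C"]
    by (auto simp: arithmetic_circuit_def)
  then have "wf (edges C)" by (rule finite_acyclic_wf)
  then show ?thesis using assms(2)
  proof (induction v rule: wf_induct_rule)
    case (less v)
    have "\<forall>u\<in>preds C v. \<exists>p. node_computes C u p"
      using less assms(1) by (auto simp: preds_def arithmetic_circuit_def)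
    then obtain f where "\<And>u. u \<in> preds C v \<Longrightarrow> node_computes C u (f u)" by metis
    then show ?case by (cases "label_of C v") (blast intro: node_computes.intros)+
  qed
qed

definition computes :: "'x circuit \<Rightarrow> 'x mpoly \<Rightarrow> bool" where
  "computes C p \<longleftrightarrow> node_computes C (root C) p"

definition min_monotone_formula_size :: "'x set \<Rightarrow> 'x mpoly \<Rightarrow> nat" where
  "min_monotone_formula_size X p =
     (LEAST s. \<exists>C. arithmetic_formula X C \<and> monotone_circuit C \<and> computes C p \<and> circuit_size C = s)"

end

theory Submission imports Defs "HOL-Library.Multiset" begin

text \<open>
  Upper bound: along an elimination tree, sum over the image of the root and multiply the formulas of
  the remaining components; every level of the tree costs a factor \<open>n\<close>.

  Lower bound: give each vertex \<open>i\<close> of \<open>H\<close> its own class of \<open>m = n div k\<close> target vertices and consider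
  only the \<open>m^k\<close> maps \<open>\<phi>\<close> that respect the classes. In a monotone formula nothing cancels, so the
  monomial of \<open>\<phi>\<close> has a parse tree, and each gate of it receives a set \<open>A\<close> of edges of \<open>H\<close>.
  Exchanging the parts of two parse trees at a common gate with the same \<open>A\<close> must again give a
  monomial of a homomorphism, which forces the two maps to agree on all vertices lying both on an edge
  in \<open>A\<close> and on an edge outside \<open>A\<close>. Binary product gates thus separate \<open>H\<close> by fixed vertices, as an
  elimination tree does, so some leaf of the parse tree fixes at least \<open>td(H)\<close> values of \<open>\<phi>\<close>. Hence a
  leaf serves at most \<open>O(m^(k - td(H)))\<close> maps.
\<close>

section \<open>Treedepth of arbitrary vertex sets\<close>

text \<open>Two obstacles shape the descent to a leaf. The edges that a gate receives depend on the
  map, and the formula may be arbitrarily deep, so the choices of edge sets cannot simply be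
  multiplied along a path. Moreover, the vertices that remain after fixing a separator need not be
  connected, so no single elimination tree describes them. The first is met by following families of
  maps that share an edge set A and agree on a set B of fixed vertices, and by paying for a choice
  only where A splits properly, which happens at most \<open>card E\<close> times on a path. The
  second is met by \<open>treedepth_le\<close>: removing a vertex costs one level, and joining parts
  with no edge between them costs nothing. The quantity that survives the descent is |B| plus the
  treedepth of the vertices that A covers outside B. At the root it is td(H), at a proper split one
  of the two factors has at least as much, and at a leaf it is at most the number of fixed
  vertices.\<close>

inductive treedepth_le :: "'a set set \<Rightarrow> 'a set \<Rightarrow> nat \<Rightarrow> bool" for E where
  empty: "treedepth_le E {} d"
| remove: "\<lbrakk>u \<in> S; treedepth_le E (S - {u}) d\<rbrakk> \<Longrightarrow> treedepth_le E S (Suc d)"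
| union: "\<lbrakk>treedepth_le E S d; treedepth_le E T d; S \<inter> T = {};
    \<And>u v. u \<in> S \<Longrightarrow> v \<in> T \<Longrightarrow> {u, v} \<notin> E\<rbrakk> \<Longrightarrow> treedepth_le E (S \<union> T) d"

lemma treedepth_le_finite: "treedepth_le E S d \<Longrightarrow> finite S"
  by (induction rule: treedepth_le.induct) auto

lemma treedepth_le_mono: "treedepth_le E S d \<Longrightarrow> d \<le> d' \<Longrightarrow> treedepth_le E S d'"
proof (induction arbitrary: d' rule: treedepth_le.induct)
  case (remove u S d)
  then obtain d'' where "d' = Suc d''" "d \<le> d''" by (cases d') auto
  with remove show ?case by (auto intro: treedepth_le.remove)
qed (auto intro: treedepth_le.intros)

lemma treedepth_le_remove_set:
  assumes "finite W" "treedepth_le E (S - W) d" "W \<subseteq> S"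
  shows "treedepth_le E S (card W + d)"
  using assms
proof (induction W arbitrary: S rule: finite_induct)
  case (insert u W)
  have "S - {u} - W = S - insert u W" by auto
  then have "treedepth_le E (S - {u}) (card W + d)"
    using insert.prems insert.hyps by (intro insert.IH) auto
  then have "treedepth_le E S (Suc (card W + d))"
    using insert.prems by (intro treedepth_le.remove[of u]) auto
  with insert.hyps show ?case by simp
qed simp

lemma treedepth_le_card: "finite S \<Longrightarrow> treedepth_le E S (card S)"
  using treedepth_le_remove_set[of S E S 0] by (auto intro: treedepth_le.empty)

lemma treedepth_le_Union:
  assumes "finite \<C>" "\<And>C. C \<in> \<C> \<Longrightarrow> treedepth_le E C d"
    and "\<And>C C'. C \<in> \<C> \<Longrightarrow> C' \<in> \<C> \<Longrightarrow> C \<noteq> C' \<Longrightarrow>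
      C \<inter> C' = {} \<and> (\<forall>u\<in>C. \<forall>v\<in>C'. {u, v} \<notin> E)"
  shows "treedepth_le E (\<Union>\<C>) d"
  using assms
proof (induction \<C> rule: finite_induct)
  case (insert C \<C>)
  have "C \<inter> C' = {}" "\<And>u v. u \<in> C \<Longrightarrow> v \<in> C' \<Longrightarrow> {u, v} \<notin> E" if "C' \<in> \<C>" for C'
    using insert.prems(2)[of C C'] insert.hyps that by (metis insertI1 insertI2)+
  then have "C \<inter> \<Union>\<C> = {}" "\<And>u v. u \<in> C \<Longrightarrow> v \<in> \<Union>\<C> \<Longrightarrow> {u, v} \<notin> E"
    by blast+
  moreover have "treedepth_le E (\<Union>\<C>) d"
    by (rule insert.IH) (use insert.prems in \<open>meson insertI2\<close>)+
  ultimately show ?case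
    using treedepth_le.union[of E C d "\<Union>\<C>"] insert.prems(1) by auto
qed (auto intro: treedepth_le.empty)

lemma adj_rtrancl_mem: "(u, v) \<in> (adj S E)\<^sup>* \<Longrightarrow> u \<in> S \<Longrightarrow> v \<in> S"
  by (induction rule: rtrancl_induct) (auto simp: adj_def)

lemma adj_rtrancl_sym: "(u, v) \<in> (adj S E)\<^sup>* \<Longrightarrow> (v, u) \<in> (adj S E)\<^sup>*"
proof -
  have "sym (adj S E)" by (auto simp: sym_def adj_def insert_commute)
  then show "(u, v) \<in> (adj S E)\<^sup>* \<Longrightarrow> (v, u) \<in> (adj S E)\<^sup>*"
    by (meson sym_rtrancl symD)
qed

text \<open>As no edge leads from S to the rest of S', a walk of S' that starts in S never leaves
  it.\<close>

lemma adj_rtrancl_closed: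
  assumes "S \<subseteq> S'" "\<And>x y. x \<in> S \<Longrightarrow> y \<in> S' - S \<Longrightarrow> {x, y} \<notin> E" "u \<in> S"
  shows "(u, v) \<in> (adj S' E)\<^sup>* \<longleftrightarrow> (u, v) \<in> (adj S E)\<^sup>*"
proof
  assume "(u, v) \<in> (adj S' E)\<^sup>*"
  then have "(u, v) \<in> (adj S E)\<^sup>* \<and> v \<in> S"
  proof (induction rule: rtrancl_induct)
    case (step y z)
    then have "z \<in> S" "(y, z) \<in> adj S E"
      using assms(2)[of y z] by (auto simp: adj_def)
    with step.IH show ?case by (meson rtrancl.rtrancl_into_rtrancl)
  qed (use assms in auto)
  then show "(u, v) \<in> (adj S E)\<^sup>*" ..
next
  have "adj S E \<subseteq> adj S' E" using assms(1) by (auto simp: adj_def)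
  then show "(u, v) \<in> (adj S E)\<^sup>* \<Longrightarrow> (u, v) \<in> (adj S' E)\<^sup>*"
    using rtrancl_mono by blast
qed

lemma component_subset: "C \<in> graph_components S E \<Longrightarrow> C \<subseteq> S"
  by (auto simp: graph_components_def dest: adj_rtrancl_mem)

lemma component_closed:
  assumes "C \<in> graph_components S E" "x \<in> C" "y \<in> S - C"
  shows "{x, y} \<notin> E"
proof
  assume "{x, y} \<in> E"
  moreover obtain w where w: "C = {v. (w, v) \<in> (adj S E)\<^sup>*}" "w \<in> S"
    using assms(1) by (auto simp: graph_components_def)
  moreover have "x \<in> S" using assms component_subset by blast
  ultimately have "(w, x) \<in> (adj S E)\<^sup>*" "(x, y) \<in> adj S E"
    using assms by (auto simp: adj_def)
  then have "(w, y) \<in> (adj S E)\<^sup>*" by (rule rtrancl.rtrancl_into_rtrancl)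
  with w assms show False by auto
qed

lemma component_eq:
  assumes "C \<in> graph_components S E" "x \<in> C"
  shows "C = {v. (x, v) \<in> (adj S E)\<^sup>*}"
  using assms by (auto simp: graph_components_def dest: adj_rtrancl_sym intro: rtrancl_trans)

text \<open>A set that no edge leaves inside S' is a union of components of S', so passing from S'
  to S neither merges nor splits a component.\<close>

lemma component_restrict:
  assumes "S \<subseteq> S'" "\<And>x y. x \<in> S \<Longrightarrow> y \<in> S' - S \<Longrightarrow> {x, y} \<notin> E"
  shows "graph_components S E \<subseteq> graph_components S' E"
    and "C \<in> graph_components S' E \<Longrightarrow> C \<inter> S \<noteq> {} \<Longrightarrow> C \<in> graph_components S E"
proof -
  have eq: "{v. (u, v) \<in> (adj S' E)\<^sup>*} = {v. (u, v) \<in> (adj S E)\<^sup>*}" if "u \<in> S" for u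
    using adj_rtrancl_closed[OF assms that] by auto
  then show "graph_components S E \<subseteq> graph_components S' E"
    using assms(1) by (auto simp: graph_components_def)
  assume C: "C \<in> graph_components S' E" "C \<inter> S \<noteq> {}"
  then obtain x where "x \<in> C" "x \<in> S" by auto
  have "C = {v. (x, v) \<in> (adj S E)\<^sup>*}"
    using component_eq[OF C(1) \<open>x \<in> C\<close>] eq[OF \<open>x \<in> S\<close>] by simp
  with \<open>x \<in> S\<close> show "C \<in> graph_components S E"
    unfolding graph_components_def by blast
qed

lemma Union_graph_components: "\<Union>(graph_components S E) = S"
proof
  show "\<Union>(graph_components S E) \<subseteq> S" using component_subset by blast
  show "S \<subseteq> \<Union>(graph_components S E)" by (auto simp: graph_components_def)
qed

lemma graph_components_connected:
  assumes "connected_graph S E"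
  shows "graph_components S E = {S}"
proof -
  have "v \<in> S \<longleftrightarrow> (u, v) \<in> (adj S E)\<^sup>*" if "u \<in> S" for u v
    using assms that adj_rtrancl_mem[of u v S E] unfolding connected_graph_def by blast
  then have "{v. (u, v) \<in> (adj S E)\<^sup>*} = S" if "u \<in> S" for u
    using that by blast
  moreover have "S \<noteq> {}" using assms by (simp add: connected_graph_def)
  ultimately show ?thesis by (simp add: graph_components_def image_constant_conv)
qed

lemma elimination_tree_treedepth_le:
  "elimination_tree E S t \<Longrightarrow> finite S \<Longrightarrow> treedepth_le E S (depth t)"
proof (induction rule: elimination_tree.induct)
  case (1 u S ts T)
  let ?\<C> = "graph_components (S - {u}) E"
  let ?d = "Max (insert 0 (depth ` T ` ?\<C>))"
  have fin: "finite ?\<C>" using 1 by (auto simp: graph_components_def)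
  have "treedepth_le E C ?d" if "C \<in> ?\<C>" for C
  proof (rule treedepth_le_mono)
    show "treedepth_le E C (depth (T C))"
      using 1 that component_subset[OF that] by (meson finite_Diff finite_subset)
    show "depth (T C) \<le> ?d" using fin that by (intro Max_ge) auto
  qed
  moreover have "C \<inter> C' = {} \<and> (\<forall>x\<in>C. \<forall>y\<in>C'. {x, y} \<notin> E)"
    if C: "C \<in> ?\<C>" "C' \<in> ?\<C>" "C \<noteq> C'" for C C'
  proof -
    have "C \<inter> C' = {}"
    proof (rule ccontr)
      assume "C \<inter> C' \<noteq> {}"
      then obtain x where "x \<in> C" "x \<in> C'" by blast
      with component_eq[OF C(1) this(1)] component_eq[OF C(2) this(2)] C(3) show False by simp
    qed
    then show ?thesis using component_closed[OF C(1)] component_subset[OF C(2)] by blast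
  qed
  ultimately have "treedepth_le E (\<Union>?\<C>) ?d"
    using fin by (intro treedepth_le_Union) auto
  then have "treedepth_le E S (Suc ?d)"
    using 1 by (intro treedepth_le.remove[of u]) (auto simp: Union_graph_components)
  with 1 show ?case by simp
qed

text \<open>A derivation may remove vertices of several components in any order. As S need not be
  connected, the claim is made for each component separately, with the same depth bound d for
  all.\<close>

lemma treedepth_le_elimination_tree:
  assumes "treedepth_le E S d" "C \<in> graph_components S E"
  shows "\<exists>t. elimination_tree E C t \<and> depth t \<le> d"
  using assms
proof (induction arbitrary: C rule: treedepth_le.induct)
  case (empty d)
  then show ?case by (simp add: graph_components_def)
next
  case (remove u S d)
  note closed = component_closed[OF remove.prems] and sub = component_subset[OF remove.prems]
  \<comment> \<open>If the removed vertex lies outside C, then C stays a component and no tree node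
    is spent. If it lies in C, it becomes the root, and the components of \<open>C - {u}\<close>
    reappear among those of \<open>S - {u}\<close>.\<close>
  show ?case
  proof (cases "u \<in> C")
    case False
    obtain w where w: "w \<in> C" using remove.prems by (auto simp: graph_components_def)
    have "C \<in> graph_components C E"
      by (rule component_restrict(2)[OF sub closed remove.prems]) (use w in auto)
    moreover have "graph_components C E \<subseteq> graph_components (S - {u}) E"
      using sub closed False by (intro component_restrict(1)) auto
    ultimately show ?thesis using remove.IH le_SucI by blast
  next
    case True
    have "graph_components (C - {u}) E \<subseteq> graph_components (S - {u}) E"
      using sub closed by (intro component_restrict(1)) auto
    then have "\<forall>D\<in>graph_components (C - {u}) E. \<exists>t. elimination_tree E D t \<and> depth t \<le> d"
      using remove.IH by blast
    then obtain T where T: "\<And>D. D \<in> graph_components (C - {u}) E \<Longrightarrow>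
        elimination_tree E D (T D) \<and> depth (T D) \<le> d"
      by metis
    have "finite C" using treedepth_le_finite[OF remove.hyps(2)] sub finite_subset by fastforce
    then have fin: "finite (T ` graph_components (C - {u}) E)"
      by (auto simp: graph_components_def)
    define ts where "ts = Abs_fset (T ` graph_components (C - {u}) E)"
    have ts: "fset ts = T ` graph_components (C - {u}) E"
      using fin by (simp add: ts_def Abs_fset_inverse)
    have "elimination_tree E C (Node u ts)"
      using True ts T by (intro elimination_tree.intros) auto
    moreover have "depth (Node u ts) \<le> Suc d"
      using T fin by (auto simp: ts)
    ultimately show ?thesis by blast
  qed
next
  case (union S d T)
  from union.prems have "C \<subseteq> S \<union> T" "C \<noteq> {}"
    using component_subset by (blast, auto simp: graph_components_def)
  then consider "C \<inter> S \<noteq> {}" | "C \<inter> T \<noteq> {}" by blast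
  then show ?case
  proof cases
    case 1
    have "C \<in> graph_components S E"
      by (rule component_restrict(2)[OF _ _ union.prems 1]) (use union.hyps in auto)
    with union.IH show ?thesis by blast
  next
    case 2
    have "{x, y} \<notin> E" if "x \<in> T" "y \<in> S" for x y
      using union.hyps(4)[of y x] that by (simp add: insert_commute)
    then have "C \<in> graph_components T E"
      by (intro component_restrict(2)[OF _ _ union.prems 2]) auto
    with union.IH show ?thesis by blast
  qed
qed

text \<open>Treedepth for disconnected and empty sets as well: components are eliminated in parallel
  without a common root, and the empty set has value 0.\<close>

definition set_treedepth :: "'a set set \<Rightarrow> 'a set \<Rightarrow> nat" where
  "set_treedepth E S = (LEAST d. treedepth_le E S d)"

lemma set_treedepth_le: "treedepth_le E S d \<Longrightarrow> set_treedepth E S \<le> d"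
  unfolding set_treedepth_def by (rule Least_le)

lemma treedepth_le_set_treedepth: "finite S \<Longrightarrow> treedepth_le E S (set_treedepth E S)"
  unfolding set_treedepth_def by (rule LeastI_ex) (use treedepth_le_card in blast)

lemma treedepth_eq_set_treedepth:
  assumes "finite S" "connected_graph S E"
  shows "treedepth S E = set_treedepth E S"
proof -
  have "\<exists>t. elimination_tree E S t \<and> depth t \<le> set_treedepth E S"
    using treedepth_le_elimination_tree[OF treedepth_le_set_treedepth[OF assms(1)]]
      graph_components_connected[OF assms(2)] by auto
  then obtain t where t: "elimination_tree E S t" "depth t \<le> set_treedepth E S" by auto
  have "treedepth S E \<le> depth t"
    unfolding treedepth_def by (rule Least_le) (use t in auto)
  moreover have "\<exists>t. elimination_tree E S t \<and> depth t = treedepth S E"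
    unfolding treedepth_def by (rule LeastI_ex) (use t in auto)
  then have "set_treedepth E S \<le> treedepth S E"
    using elimination_tree_treedepth_le[OF _ assms(1)] set_treedepth_le by metis
  ultimately show ?thesis using t by simp
qed

lemma set_treedepth_pos:
  assumes "finite S" "S \<noteq> {}"
  shows "set_treedepth E S > 0"
proof (rule ccontr)
  assume "\<not> ?thesis"
  with treedepth_le_set_treedepth[OF assms(1), of E] have "treedepth_le E S 0" by simp
  then have "S = {}" by (induction "0::nat" rule: treedepth_le.induct) auto
  with assms show False by simp
qed

text \<open>Eliminating W costs \<open>card W\<close>, after which the two sides share the remaining
  levels. In the lower bound W consists of the vertices common to two factors, and the maximum says
  that one factor inherits all of the remaining treedepth.\<close>

lemma set_treedepth_separate:
  assumes "finite S" "W \<subseteq> S" "S - W = S1 \<union> S2" "S1 \<inter> S2 = {}"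
    "\<And>u v. u \<in> S1 \<Longrightarrow> v \<in> S2 \<Longrightarrow> {u, v} \<notin> E"
  shows "set_treedepth E S \<le> card W + max (set_treedepth E S1) (set_treedepth E S2)"
proof -
  let ?d = "max (set_treedepth E S1) (set_treedepth E S2)"
  have "finite (S - W)" using assms by blast
  then have "finite S1" "finite S2" using assms(3) by auto
  then have "treedepth_le E S1 ?d" "treedepth_le E S2 ?d"
    by (meson treedepth_le_mono treedepth_le_set_treedepth max.cobounded1 max.cobounded2)+
  then have "treedepth_le E (S - W) ?d"
    unfolding assms(3) using assms(4,5) by (rule treedepth_le.union)
  then have "treedepth_le E S (card W + ?d)"
    using assms finite_subset by (intro treedepth_le_remove_set) auto
  then show ?thesis by (rule set_treedepth_le)
qed

section \<open>Binary monotone formulas\<close>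

text \<open>Products with exactly two factors cut a monomial into one part for each factor, and the
  number of leaves is a size measure that adds up over subformulas.\<close>

datatype 'x bform = FVar 'x | FConst rat | FAdd "'x bform" "'x bform" | FMul "'x bform" "'x bform"

primrec leaves :: "'x bform \<Rightarrow> nat" where
  "leaves (FVar x) = 1"
| "leaves (FConst c) = 1"
| "leaves (FAdd f g) = leaves f + leaves g"
| "leaves (FMul f g) = leaves f + leaves g"

primrec value_of :: "'x bform \<Rightarrow> 'x mpoly" where
  "value_of (FVar x) = var_poly x"
| "value_of (FConst c) = const_poly c"
| "value_of (FAdd f g) = value_of f + value_of g"
| "value_of (FMul f g) = value_of f * value_of g"

primrec monotone_form :: "'x bform \<Rightarrow> bool" where
  "monotone_form (FVar x) \<longleftrightarrow> True"
| "monotone_form (FConst c) \<longleftrightarrow> 0 \<le> c"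
| "monotone_form (FAdd f g) \<longleftrightarrow> monotone_form f \<and> monotone_form g"
| "monotone_form (FMul f g) \<longleftrightarrow> monotone_form f \<and> monotone_form g"

primrec vars_of :: "'x bform \<Rightarrow> 'x set" where
  "vars_of (FVar x) = {x}"
| "vars_of (FConst c) = {}"
| "vars_of (FAdd f g) = vars_of f \<union> vars_of g"
| "vars_of (FMul f g) = vars_of f \<union> vars_of g"

text \<open>The support of the polynomial, read off the syntax with coefficients dropped. Monomials
  are multisets, so that a factor of a monomial is a sub-multiset. A zero constant has empty
  support, which also empties every product with it.\<close>

primrec monomials :: "'x bform \<Rightarrow> 'x multiset set" where
  "monomials (FVar x) = {{#x#}}"
| "monomials (FConst c) = (if c = 0 then {} else {{#}})"
| "monomials (FAdd f g) = monomials f \<union> monomials g"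
| "monomials (FMul f g) = {a + b | a b. a \<in> monomials f \<and> b \<in> monomials g}"

lemma leaves_pos: "leaves f > 0"
  by (induction f) auto

lemma const_poly_0 [simp]: "const_poly 0 = 0" and const_poly_1 [simp]: "const_poly 1 = 1"
  by (simp_all add: const_poly_def)

text \<open>The empty sum still needs a leaf for the constant 0; this is the extra 1 in the
  bound.\<close>

lemma ex_sum_bform:
  assumes "finite U" "\<And>u. u \<in> U \<Longrightarrow> monotone_form (F u) \<and> vars_of (F u) \<subseteq> X"
  shows "\<exists>f. monotone_form f \<and> vars_of f \<subseteq> X \<and> value_of f = (\<Sum>u\<in>U. value_of (F u)) \<and>
    leaves f \<le> (\<Sum>u\<in>U. leaves (F u)) + (if U = {} then 1 else 0)"
  using assms
proof (induction U rule: finite_induct)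
  case empty
  show ?case by (rule exI[of _ "FConst 0"]) simp
next
  case (insert u U)
  then obtain f where f: "monotone_form f" "vars_of f \<subseteq> X" "value_of f = (\<Sum>u\<in>U. value_of (F u))"
    "leaves f \<le> (\<Sum>u\<in>U. leaves (F u)) + (if U = {} then 1 else 0)" by auto
  show ?case
  proof (cases "U = {}")
    case True
    with insert show ?thesis by (intro exI[of _ "F u"]) auto
  next
    case False
    with insert f show ?thesis by (intro exI[of _ "FAdd (F u) f"]) auto
  qed
qed

lemma ex_prod_bform:
  assumes "finite U" "\<And>u. u \<in> U \<Longrightarrow> monotone_form (F u) \<and> vars_of (F u) \<subseteq> X"
  shows "\<exists>f. monotone_form f \<and> vars_of f \<subseteq> X \<and> value_of f = (\<Prod>u\<in>U. value_of (F u)) \<and>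
    leaves f \<le> (\<Sum>u\<in>U. leaves (F u)) + (if U = {} then 1 else 0)"
  using assms
proof (induction U rule: finite_induct)
  case empty
  show ?case by (rule exI[of _ "FConst 1"]) simp
next
  case (insert u U)
  then obtain f where f: "monotone_form f" "vars_of f \<subseteq> X" "value_of f = (\<Prod>u\<in>U. value_of (F u))"
    "leaves f \<le> (\<Sum>u\<in>U. leaves (F u)) + (if U = {} then 1 else 0)" by auto
  show ?case
  proof (cases "U = {}")
    case True
    with insert show ?thesis by (intro exI[of _ "F u"]) auto
  next
    case False
    with insert f show ?thesis by (intro exI[of _ "FMul (F u) f"]) auto
  qed
qed

section \<open>Supports of polynomials with non-negative coefficients\<close>

definition exponents :: "'x multiset \<Rightarrow> 'x \<Rightarrow>\<^sub>0 nat" where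
  "exponents M = (\<Sum>x\<in>#M. Poly_Mapping.single x 1)"

lemma exponents_simps [simp]:
  "exponents {#} = 0" "exponents {#x#} = Poly_Mapping.single x 1"
  "exponents (M + N) = exponents M + exponents N"
  by (simp_all add: exponents_def)

lemma lookup_exponents: "Poly_Mapping.lookup (exponents M) x = count M x"
  unfolding exponents_def by (induction M) (auto simp: lookup_add lookup_single when_def)

lemma inj_exponents: "inj exponents"
  by (rule injI, rule multiset_eqI) (metis lookup_exponents)

lemma prod_var_poly:
  "finite I \<Longrightarrow> (\<Prod>i\<in>I. var_poly (f i)) =
    Poly_Mapping.single (exponents (image_mset f (mset_set I))) 1"
  by (induction I rule: finite_induct) (auto simp: var_poly_def mult_single exponents_def)

lemma poly_mapping_sum_single:
  "p = (\<Sum>a\<in>Poly_Mapping.keys p. Poly_Mapping.single a (Poly_Mapping.lookup p a))"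
proof (rule poly_mapping_eqI)
  fix k
  have "(\<Sum>a\<in>Poly_Mapping.keys p. Poly_Mapping.lookup p a when a = k) =
      (\<Sum>a\<in>Poly_Mapping.keys p. if a = k then Poly_Mapping.lookup p a else 0)"
    by (simp add: when_def)
  also have "\<dots> = Poly_Mapping.lookup p k"
    by (simp add: sum.delta in_keys_iff)
  finally show "Poly_Mapping.lookup p k = Poly_Mapping.lookup
      (\<Sum>a\<in>Poly_Mapping.keys p. Poly_Mapping.single a (Poly_Mapping.lookup p a)) k"
    by (simp add: lookup_sum lookup_single)
qed

lemma lookup_mult_sum:
  fixes p q :: "'a::comm_monoid_add \<Rightarrow>\<^sub>0 'b::comm_semiring_1"
  shows "Poly_Mapping.lookup (p * q) k =
    (\<Sum>a\<in>Poly_Mapping.keys p. \<Sum>b\<in>Poly_Mapping.keys q.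
      (Poly_Mapping.lookup p a * Poly_Mapping.lookup q b when a + b = k))"
proof -
  have "p * q = (\<Sum>a\<in>Poly_Mapping.keys p. Poly_Mapping.single a (Poly_Mapping.lookup p a)) *
    (\<Sum>b\<in>Poly_Mapping.keys q. Poly_Mapping.single b (Poly_Mapping.lookup q b))"
    by (simp flip: poly_mapping_sum_single)
  also have "\<dots> = (\<Sum>a\<in>Poly_Mapping.keys p. \<Sum>b\<in>Poly_Mapping.keys q.
      Poly_Mapping.single (a + b) (Poly_Mapping.lookup p a * Poly_Mapping.lookup q b))"
    by (simp add: sum_product mult_single)
  finally show ?thesis by (simp add: lookup_sum lookup_single)
qed

text \<open>The coefficient at \<open>a + b\<close> is a sum of non-negative terms, one of which is
  the positive product of the coefficients at a and b. With coefficients of both signs only one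
  inclusion would hold.\<close>

lemma keys_mult_nonneg:
  fixes p q :: "'a::comm_monoid_add \<Rightarrow>\<^sub>0 rat"
  assumes "\<And>a. Poly_Mapping.lookup p a \<ge> 0" "\<And>a. Poly_Mapping.lookup q a \<ge> 0"
  shows "Poly_Mapping.keys (p * q) =
    {a + b | a b. a \<in> Poly_Mapping.keys p \<and> b \<in> Poly_Mapping.keys q}"
proof
  show "{a + b | a b. a \<in> Poly_Mapping.keys p \<and> b \<in> Poly_Mapping.keys q} \<subseteq> Poly_Mapping.keys (p * q)"
  proof safe
    fix a b assume ab: "a \<in> Poly_Mapping.keys p" "b \<in> Poly_Mapping.keys q"
    let ?t = "\<lambda>a' b'. Poly_Mapping.lookup p a' * Poly_Mapping.lookup q b' when a' + b' = a + b"
    have nn: "?t a' b' \<ge> 0" for a' b' using assms by (simp add: when_def)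
    have "Poly_Mapping.lookup p a > 0" "Poly_Mapping.lookup q b > 0"
      using ab assms by (simp_all add: in_keys_iff order_less_le)
    then have "0 < ?t a b" by simp
    also have "\<dots> \<le> (\<Sum>b'\<in>Poly_Mapping.keys q. ?t a b')"
      using ab nn by (intro member_le_sum) auto
    also have "\<dots> \<le> (\<Sum>a'\<in>Poly_Mapping.keys p. \<Sum>b'\<in>Poly_Mapping.keys q. ?t a' b')"
      using ab nn by (intro member_le_sum[of a _ "\<lambda>a'. \<Sum>b'\<in>Poly_Mapping.keys q. ?t a' b'"])
        (auto intro: sum_nonneg)
    finally show "a + b \<in> Poly_Mapping.keys (p * q)"
      by (simp add: in_keys_iff lookup_mult_sum)
  qed
qed (rule keys_mult)

lemma keys_add_nonneg:
  fixes p q :: "'a \<Rightarrow>\<^sub>0 rat"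
  assumes "\<And>a. Poly_Mapping.lookup p a \<ge> 0" "\<And>a. Poly_Mapping.lookup q a \<ge> 0"
  shows "Poly_Mapping.keys (p + q) = Poly_Mapping.keys p \<union> Poly_Mapping.keys q"
  using add_nonneg_eq_0_iff[OF assms] by (auto simp: in_keys_iff lookup_add)

lemma lookup_value_of_nonneg: "monotone_form f \<Longrightarrow> Poly_Mapping.lookup (value_of f) a \<ge> 0"
proof (induction f arbitrary: a)
  case (FMul f g)
  then show ?case by (auto simp: lookup_mult_sum when_def intro!: sum_nonneg)
qed (auto simp: var_poly_def const_poly_def lookup_single lookup_add when_def)

lemma keys_value_of:
  "monotone_form f \<Longrightarrow> Poly_Mapping.keys (value_of f) = exponents ` monomials f"
proof (induction f)
  case (FAdd f g)
  then have "Poly_Mapping.keys (value_of f + value_of g) =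
      Poly_Mapping.keys (value_of f) \<union> Poly_Mapping.keys (value_of g)"
    using lookup_value_of_nonneg by (intro keys_add_nonneg) auto
  with FAdd show ?case by auto
next
  case (FMul f g)
  then have "Poly_Mapping.keys (value_of f * value_of g) =
    {a + b | a b. a \<in> Poly_Mapping.keys (value_of f) \<and> b \<in> Poly_Mapping.keys (value_of g)}"
    using lookup_value_of_nonneg by (intro keys_mult_nonneg) auto
  also have "\<dots> = exponents ` monomials (FMul f g)"
  proof -
    have "exponents a + exponents b \<in> exponents ` monomials (FMul f g)"
      if "a \<in> monomials f" "b \<in> monomials g" for a b
      by (rule image_eqI[of _ _ "a + b"]) (use that in auto)
    with FMul show ?thesis by fastforce
  qed
  finally show ?case by simp
qed (auto simp: var_poly_def const_poly_def)

text \<open>Each homomorphism adds 1 to the coefficient of its monomial, so coefficients count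
  homomorphisms and nothing cancels.\<close>

lemma keys_hom_poly:
  assumes "finite V" "finite E"
  shows "Poly_Mapping.keys (hom_poly V E n) =
    (\<lambda>\<phi>. exponents (image_mset ((`) \<phi>) (mset_set E))) ` graph_homs V E {1..n} (complete_edges n)"
proof -
  let ?H = "graph_homs V E {1..n} (complete_edges n)"
  let ?m = "\<lambda>\<phi>. exponents (image_mset ((`) \<phi>) (mset_set E))"
  have fin: "finite ?H"
    using assms by (intro finite_subset[OF _ finite_PiE[of V "\<lambda>_. {1..n}"]])
      (auto simp: graph_homs_def)
  have "Poly_Mapping.lookup (hom_poly V E n) a = (\<Sum>\<phi>\<in>?H. if ?m \<phi> = a then 1 else 0)" for a
    using assms by (simp add: hom_poly_def lookup_sum prod_var_poly lookup_single when_def)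
  then have "a \<in> Poly_Mapping.keys (hom_poly V E n) \<longleftrightarrow> (\<exists>\<phi>\<in>?H. ?m \<phi> = a)" for a
    using fin by (auto simp: in_keys_iff sum_nonneg_eq_0_iff)
  then show ?thesis by auto
qed

lemma monomials_hom_poly:
  assumes "finite V" "finite E" "monotone_form f" "value_of f = hom_poly V E n"
  shows "monomials f = (\<lambda>\<phi>. image_mset ((`) \<phi>) (mset_set E)) ` graph_homs V E {1..n} (complete_edges n)"
proof -
  have "exponents ` monomials f =
      exponents ` (\<lambda>\<phi>. image_mset ((`) \<phi>) (mset_set E)) ` graph_homs V E {1..n} (complete_edges n)"
    using keys_value_of[OF assms(3)] keys_hom_poly[OF assms(1,2), of n] assms(4)
    by (simp add: image_image)
  then show ?thesis by (simp add: inj_image_eq_iff[OF inj_exponents])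
qed

section \<open>Circuits and binary formulas\<close>

text \<open>The edges of the subtree at v. Edges are counted rather than nodes because a source may
  feed several gates, whereas every edge ends in a gate and gates have out-degree at most
  one.\<close>

definition edges_below :: "'x circuit \<Rightarrow> nat \<Rightarrow> (nat \<times> nat) set" where
  "edges_below C v = {(a, b). (a, b) \<in> edges C \<and> (b, v) \<in> (edges C)\<^sup>*}"

text \<open>The walks from a gate b follow a single path. If it met two different predecessors of v,
  it would pass from one of them through v to the other and close a cycle.\<close>

lemma formula_gate_pred_unique:
  assumes C: "arithmetic_formula X C" and b: "preds C b \<noteq> {}"
    and u: "(b, u) \<in> (edges C)\<^sup>*" and u': "(b, u') \<in> (edges C)\<^sup>*"
    and uv: "(u, v) \<in> edges C" "(u', v) \<in> edges C"
  shows "u = u'"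
proof -
  have AC: "finite (nodes C)" "edges C \<subseteq> nodes C \<times> nodes C" "acyclic (edges C)"
    "\<And>v. v \<in> nodes C \<Longrightarrow> preds C v \<noteq> {} \<Longrightarrow> label_of C v \<in> {Plus, Times}"
    "\<And>v. v \<in> nodes C \<Longrightarrow> label_of C v \<in> {Plus, Times} \<Longrightarrow> card (succs C v) \<le> 1"
    using C by (auto simp: arithmetic_formula_def arithmetic_circuit_def split: if_splits)
  \<comment> \<open>Only edges that start in a gate: there the out-degree bound applies, which makes
    \<open>r\<close> a partial function.\<close>
  define r where "r = {(x, y). (x, y) \<in> edges C \<and> preds C x \<noteq> {}}"
  have "single_valued r"
  proof (rule single_valuedI)
    fix x y z assume "(x, y) \<in> r" "(x, z) \<in> r"
    then have *: "x \<in> nodes C" "preds C x \<noteq> {}" "y \<in> succs C x" "z \<in> succs C x"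
      using AC(2) by (auto simp: r_def succs_def)
    have "finite (succs C x)"
      using AC(1,2) by (auto simp: succs_def intro: finite_subset)
    then show "y = z"
      using AC(4,5)[OF *(1)] * by (simp add: card_le_Suc0_iff_eq)
  qed
  have path: "(b, w) \<in> r\<^sup>* \<and> preds C w \<noteq> {}" if "(b, w) \<in> (edges C)\<^sup>*" for w
    using that
  proof (induction rule: rtrancl_induct)
    case (step y z)
    then have "(y, z) \<in> r" "preds C z \<noteq> {}" by (auto simp: r_def preds_def)
    with step show ?case by (auto intro: rtrancl.rtrancl_into_rtrancl)
  qed (use b in auto)
  have cycle: "x = x'" if x: "(x, x') \<in> r\<^sup>*" "(x, v) \<in> r" "(x', v) \<in> edges C" for x x'
    using x(1)
  proof (cases rule: converse_rtranclE)
    case (step z)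
    then have "z = v" using \<open>single_valued r\<close> x(2) by (auto dest: single_valuedD)
    with step have "(v, x') \<in> (edges C)\<^sup>*"
      using rtrancl_mono[of r "edges C"] by (auto simp: r_def)
    then have "(v, v) \<in> (edges C)\<^sup>+" using x(3) by (rule rtrancl_into_trancl1)
    with AC(3) show ?thesis by (auto simp: acyclic_def)
  qed
  have "(u, v) \<in> r" "(u', v) \<in> r" using path[OF u] path[OF u'] uv by (auto simp: r_def)
  moreover have "(u, u') \<in> r\<^sup>* \<or> (u', u) \<in> r\<^sup>*"
    using single_valued_confluent[OF \<open>single_valued r\<close>] path[OF u] path[OF u'] by blast
  ultimately show ?thesis using cycle uv by metis
qed

text \<open>The subtrees of distinct predecessors share no edge, since a common edge would end in a
  gate that leads to both. The added 1 is the edge from u to v.\<close>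

lemma sum_card_edges_below:
  assumes C: "arithmetic_formula X C"
  shows "(\<Sum>u\<in>preds C v. card (edges_below C u) + 1) \<le> card (edges_below C v)"
proof -
  have AC: "finite (nodes C)" "edges C \<subseteq> nodes C \<times> nodes C" "acyclic (edges C)"
    using C by (auto simp: arithmetic_formula_def arithmetic_circuit_def)
  have finE: "finite (edges C)" using AC(1,2) by (auto intro: finite_subset)
  have fin: "finite (edges_below C w)" for w
    using finE by (rule finite_subset[rotated]) (auto simp: edges_below_def)
  have finp: "finite (preds C v)"
    using AC(1,2) by (auto simp: preds_def intro: finite_subset)
  have cycle: False if "(v, u) \<in> (edges C)\<^sup>*" "(u, v) \<in> edges C" for u
    using AC(3) rtrancl_into_trancl1[OF that] by (auto simp: acyclic_def)
  let ?B = "\<lambda>u. insert (u, v) (edges_below C u)"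
  have disj: "?B u \<inter> ?B u' = {}" if "u \<in> preds C v" "u' \<in> preds C v" "u \<noteq> u'" for u u'
  proof (rule ccontr)
    assume "?B u \<inter> ?B u' \<noteq> {}"
    then obtain a b where ab: "(a, b) \<in> ?B u" "(a, b) \<in> ?B u'" by auto
    have uv: "(u, v) \<in> edges C" "(u', v) \<in> edges C" using that by (auto simp: preds_def)
    have "(u, v) \<notin> edges_below C u'" "(u', v) \<notin> edges_below C u"
      using cycle uv by (auto simp: edges_below_def)
    with ab that(3) have "(a, b) \<in> edges_below C u" "(a, b) \<in> edges_below C u'" by auto
    then have "preds C b \<noteq> {}" "(b, u) \<in> (edges C)\<^sup>*" "(b, u') \<in> (edges C)\<^sup>*"
      by (auto simp: edges_below_def preds_def)
    from formula_gate_pred_unique[OF C this uv] that(3) show False by simp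
  qed
  have "card (?B u) = card (edges_below C u) + 1" if "u \<in> preds C v" for u
  proof -
    have "(u, v) \<notin> edges_below C u"
      using cycle[of u] that by (auto simp: edges_below_def preds_def)
    with fin show ?thesis by simp
  qed
  then have "(\<Sum>u\<in>preds C v. card (edges_below C u) + 1) = card (\<Union>u\<in>preds C v. ?B u)"
    using card_UN_disjoint[of "preds C v" ?B] finp fin disj by auto
  also have "\<dots> \<le> card (edges_below C v)"
    using fin by (intro card_mono)
      (auto simp: edges_below_def preds_def intro: rtrancl.rtrancl_into_rtrancl)
  finally show ?thesis .
qed

text \<open>Unfolding the circuit below v copies a shared source once for each of its edges. No edge
  is gained, and a tree has at most one leaf more than it has edges.\<close>

lemma node_computes_bform:
  assumes C: "arithmetic_formula X C" "monotone_circuit C"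
  shows "node_computes C v p \<Longrightarrow> v \<in> nodes C \<Longrightarrow>
    \<exists>f. monotone_form f \<and> value_of f = p \<and> leaves f \<le> card (edges_below C v) + 1"
proof (induction rule: node_computes.induct)
  case (1 v x)
  show ?case by (rule exI[of _ "FVar x"]) simp
next
  case (2 v c)
  then have "0 \<le> c" using C(2) by (auto simp: monotone_circuit_def)
  then show ?case by (intro exI[of _ "FConst c"]) simp
next
  case (3 v f)
  have sub: "preds C v \<subseteq> nodes C" "finite (preds C v)" "preds C v \<noteq> {}"
    using C(1) 3(1,4)
    by (auto simp: arithmetic_formula_def arithmetic_circuit_def preds_def intro: finite_subset
      split: if_splits)
  with 3 have "\<forall>u\<in>preds C v. \<exists>g. monotone_form g \<and> value_of g = f u \<and>
      leaves g \<le> card (edges_below C u) + 1"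
    by blast
  then obtain G where G: "\<And>u. u \<in> preds C v \<Longrightarrow> monotone_form (G u) \<and> value_of (G u) = f u \<and>
      leaves (G u) \<le> card (edges_below C u) + 1"
    by metis
  obtain g where g: "monotone_form g" "value_of g = (\<Sum>u\<in>preds C v. value_of (G u))"
    "leaves g \<le> (\<Sum>u\<in>preds C v. leaves (G u))"
    using ex_sum_bform[of "preds C v" G UNIV] G sub by auto
  have "(\<Sum>u\<in>preds C v. leaves (G u)) \<le> (\<Sum>u\<in>preds C v. card (edges_below C u) + 1)"
    using G by (intro sum_mono) auto
  with g sum_card_edges_below[OF C(1), of v] G show ?case
    by (intro exI[of _ g]) auto
next
  case (4 v f)
  have sub: "preds C v \<subseteq> nodes C" "finite (preds C v)" "preds C v \<noteq> {}"
    using C(1) 4(1,4)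
    by (auto simp: arithmetic_formula_def arithmetic_circuit_def preds_def intro: finite_subset
      split: if_splits)
  with 4 have "\<forall>u\<in>preds C v. \<exists>g. monotone_form g \<and> value_of g = f u \<and>
      leaves g \<le> card (edges_below C u) + 1"
    by blast
  then obtain G where G: "\<And>u. u \<in> preds C v \<Longrightarrow> monotone_form (G u) \<and> value_of (G u) = f u \<and>
      leaves (G u) \<le> card (edges_below C u) + 1"
    by metis
  obtain g where g: "monotone_form g" "value_of g = (\<Prod>u\<in>preds C v. value_of (G u))"
    "leaves g \<le> (\<Sum>u\<in>preds C v. leaves (G u))"
    using ex_prod_bform[of "preds C v" G UNIV] G sub by auto
  have "(\<Sum>u\<in>preds C v. leaves (G u)) \<le> (\<Sum>u\<in>preds C v. card (edges_below C u) + 1)"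
    using G by (intro sum_mono) auto
  with g sum_card_edges_below[OF C(1), of v] G show ?case
    by (intro exI[of _ g]) auto
qed

lemma circuit_to_bform:
  assumes "arithmetic_formula X C" "monotone_circuit C" "computes C p"
  shows "\<exists>f. monotone_form f \<and> value_of f = p \<and> leaves f \<le> circuit_size C + 1"
proof -
  have *: "root C \<in> nodes C" "finite (edges C)"
    using assms(1) by (auto simp: arithmetic_formula_def arithmetic_circuit_def intro: finite_subset)
  obtain f where f: "monotone_form f" "value_of f = p"
    "leaves f \<le> card (edges_below C (root C)) + 1"
    using node_computes_bform[OF assms(1,2)] assms(3) * by (auto simp: computes_def)
  have "card (edges_below C (root C)) \<le> circuit_size C"
    unfolding circuit_size_def using * by (intro card_mono) (auto simp: edges_below_def)
  with f show ?thesis by (intro exI[of _ f]) auto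
qed

section \<open>From binary formulas to circuits\<close>

lemma node_computes_transfer:
  assumes "node_computes C v p" "v \<in> N"
    and "\<And>v. v \<in> N \<Longrightarrow> label_of C' v = label_of C v \<and> preds C' v = preds C v \<and> preds C v \<subseteq> N"
  shows "node_computes C' v p"
  using assms(1,2)
proof (induction rule: node_computes.induct)
  case (3 v f)
  then have "node_computes C' v (\<Sum>u\<in>preds C' v. f u)"
    using assms(3)[of v] by (intro node_computes.intros(3)) auto
  with 3 assms(3)[of v] show ?case by simp
next
  case (4 v f)
  then have "node_computes C' v (\<Prod>u\<in>preds C' v. f u)"
    using assms(3)[of v] by (intro node_computes.intros(4)) auto
  with 4 assms(3)[of v] show ?case by simp
qed (use assms(3) in \<open>auto intro: node_computes.intros\<close>)

text \<open>The interval of node names makes it possible to juxtapose formulas, and increasing edges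
  make the result acyclic.\<close>

definition interval_formula :: "'x set \<Rightarrow> nat \<Rightarrow> nat \<Rightarrow> 'x circuit \<Rightarrow> bool" where
  "interval_formula X a b C \<longleftrightarrow> arithmetic_formula X C \<and> monotone_circuit C \<and>
     nodes C = {a..b} \<and> root C = b \<and> (\<forall>(u, v)\<in>edges C. u < v)"

lemma interval_formulaD:
  assumes "interval_formula X a b C"
  shows "edges C \<subseteq> {a..b} \<times> {a..b}" "nodes C = {a..b}" "root C = b" "a \<le> b"
    "\<And>v. v \<in> {a..b} \<Longrightarrow> (v, b) \<in> (edges C)\<^sup>*" "monotone_circuit C"
    "\<And>v. v \<in> {a..b} \<Longrightarrow> if preds C v = {} then label_of C v \<in> Var ` X \<union> range Const
      else label_of C v \<in> {Plus, Times}"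
    "\<And>v. v \<in> {a..b} \<Longrightarrow> label_of C v \<in> {Plus, Times} \<Longrightarrow> card (succs C v) \<le> 1"
    "\<And>u v. (u, v) \<in> edges C \<Longrightarrow> u < v"
proof -
  show C: "nodes C = {a..b}" "root C = b" "monotone_circuit C"
    and incr: "\<And>u v. (u, v) \<in> edges C \<Longrightarrow> u < v"
    using assms unfolding interval_formula_def by blast+
  have A: "arithmetic_formula X C" using assms by (simp add: interval_formula_def)
  then have "arithmetic_circuit X C" by (simp add: arithmetic_formula_def)
  note circ = this[unfolded arithmetic_circuit_def C]
  from circ show "edges C \<subseteq> {a..b} \<times> {a..b}" by (elim conjE)
  from circ have "b \<in> {a..b}" by (elim conjE)
  then show "a \<le> b" by simp
  from circ show "(v, b) \<in> (edges C)\<^sup>*" if "v \<in> {a..b}" for v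
    using that by (elim conjE) (rule bspec)
  from circ show "if preds C v = {} then label_of C v \<in> Var ` X \<union> range Const
      else label_of C v \<in> {Plus, Times}" if "v \<in> {a..b}" for v
    using that by (elim conjE) (rule bspec)
  from A show "card (succs C v) \<le> 1" if "v \<in> {a..b}" "label_of C v \<in> {Plus, Times}" for v
    using that C(1) unfolding arithmetic_formula_def by blast
qed

text \<open>Two formulas side by side under a new gate \<open>Suc c\<close>. That their roots differ
  matters for the value: a gate works on the set of its predecessors, so two equal arguments must
  still come from two nodes.\<close>

lemma interval_formula_combine:
  assumes C1: "interval_formula X a b C1" and C2: "interval_formula X (Suc b) c C2"
    and l: "l \<in> {Plus, Times}"
  defines "C \<equiv> \<lparr>nodes = {a..Suc c}, edges = edges C1 \<union> edges C2 \<union> {(b, Suc c), (c, Suc c)},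
      label_of = (\<lambda>v. if v = Suc c then l else if v \<le> b then label_of C1 v else label_of C2 v),
      root = Suc c\<rparr>"
  shows "interval_formula X a (Suc c) C"
    and "circuit_size C \<le> circuit_size C1 + circuit_size C2 + 2"
    and "computes C1 p \<Longrightarrow> node_computes C b p"
    and "computes C2 p \<Longrightarrow> node_computes C c p"
    and "preds C (Suc c) = {b, c}" and "b \<noteq> c"
proof -
  note A1 = interval_formulaD[OF C1] and A2 = interval_formulaD[OF C2]
  have E: "edges C = edges C1 \<union> edges C2 \<union> {(b, Suc c), (c, Suc c)}" by (simp add: C_def)
  have incr: "\<forall>(u, v)\<in>edges C. u < v" using A1(9) A2(4,9) by (auto simp: E)
  have "(u, v) \<in> (edges C)\<^sup>+ \<Longrightarrow> u < v" for u v
    by (induction rule: trancl_induct) (use incr in fastforce)+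
  then have acy: "acyclic (edges C)" by (auto simp: acyclic_def)
  have P1: "preds C v = preds C1 v" "label_of C v = label_of C1 v" "preds C1 v \<subseteq> {a..b}"
    if "v \<in> {a..b}" for v
    using that A1(1) A2(1,4) by (auto simp: preds_def C_def)
  have P2: "preds C v = preds C2 v" "label_of C v = label_of C2 v" "preds C2 v \<subseteq> {Suc b..c}"
    if "v \<in> {Suc b..c}" for v
    using that A1(1) A2(1,4) by (auto simp: preds_def C_def)
  show P: "preds C (Suc c) = {b, c}"
    using A1(1) A2(1,4) by (auto simp: preds_def C_def)
  show "b \<noteq> c" using A2(4) by simp
  have S1: "succs C v \<subseteq> (if v = b then {Suc c} else succs C1 v)" if "v \<in> {a..b}" for v
    using that A1(1,9) A2(1,4) by (fastforce simp: succs_def E)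
  have S2: "succs C v \<subseteq> (if v = c then {Suc c} else succs C2 v)" if "v \<in> {Suc b..c}" for v
    using that A1(1) A2(1,4,9) by (fastforce simp: succs_def E)
  have fin: "finite (edges C1)" "finite (edges C2)"
    using A1(1) A2(1) by (auto intro: finite_subset)
  have fs: "finite (succs C1 v)" "finite (succs C2 v)" for v
    using A1(1) A2(1) finite_subset[of "succs C1 v" "{a..b}"] finite_subset[of "succs C2 v" "{Suc b..c}"]
    by (auto simp: succs_def)
  have N: "{a..Suc c} = {a..b} \<union> {Suc b..c} \<union> {Suc c}" using A1(4) A2(4) by auto
  have sz: "card (succs C v) \<le> 1" if "v \<in> {a..Suc c}" "label_of C v \<in> {Plus, Times}" for v
  proof -
    from that(1) N consider "v \<in> {a..b}" | "v \<in> {Suc b..c}" | "v = Suc c" by blast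
    then show ?thesis
    proof cases
      case 1
      have "card (succs C v) \<le> card (if v = b then {Suc c} else succs C1 v)"
        by (rule card_mono[OF _ S1[OF 1]]) (use fs in auto)
      also have "\<dots> \<le> 1" using A1(8)[OF 1] P1(2)[OF 1] that by (cases "v = b") auto
      finally show ?thesis .
    next
      case 2
      have "card (succs C v) \<le> card (if v = c then {Suc c} else succs C2 v)"
        by (rule card_mono[OF _ S2[OF 2]]) (use fs in auto)
      also have "\<dots> \<le> 1" using A2(8)[OF 2] P2(2)[OF 2] that by (cases "v = c") auto
      finally show ?thesis .
    next
      case 3
      then have "succs C v = {}" using A1(1) A2(1,4) by (auto simp: succs_def E)
      then show ?thesis by simp
    qed
  qed
  have reach: "(v, Suc c) \<in> (edges C)\<^sup>*" if "v \<in> {a..Suc c}" for v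
  proof -
    have mono: "(edges C1)\<^sup>* \<subseteq> (edges C)\<^sup>*" "(edges C2)\<^sup>* \<subseteq> (edges C)\<^sup>*"
      by (rule rtrancl_mono; simp add: E; blast)+
    have top: "(b, Suc c) \<in> edges C" "(c, Suc c) \<in> edges C" by (auto simp: E)
    from that N consider "v \<in> {a..b}" | "v \<in> {Suc b..c}" | "v = Suc c" by blast
    then show ?thesis
    proof cases
      case 1
      with A1(5) mono(1) have "(v, b) \<in> (edges C)\<^sup>*" by blast
      with top show ?thesis by (meson rtrancl.rtrancl_into_rtrancl)
    next
      case 2
      with A2(5) mono(2) have "(v, c) \<in> (edges C)\<^sup>*" by blast
      with top show ?thesis by (meson rtrancl.rtrancl_into_rtrancl)
    qed simp
  qed
  have lab: "if preds C v = {} then label_of C v \<in> Var ` X \<union> range Const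
      else label_of C v \<in> {Plus, Times}" if "v \<in> {a..Suc c}" for v
  proof -
    from that N consider "v \<in> {a..b}" | "v \<in> {Suc b..c}" | "v = Suc c" by blast
    then show ?thesis
    proof cases
      case 1 then show ?thesis using A1(7)[OF 1] by (simp only: P1[OF 1])
    next
      case 2 then show ?thesis using A2(7)[OF 2] by (simp only: P2[OF 2])
    next
      case 3
      then have "label_of C v = l" by (simp add: C_def)
      with 3 l show ?thesis by (simp add: P)
    qed
  qed
  have fields: "nodes C = {a..Suc c}" "root C = Suc c" by (simp_all add: C_def)
  have "edges C \<subseteq> {a..Suc c} \<times> {a..Suc c}" using A1(1,4) A2(1,4) by (auto simp: E)
  moreover have "finite {a..Suc c}" "Suc c \<in> {a..Suc c}" using A1(4) A2(4) by simp_all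
  ultimately have "arithmetic_circuit X C"
    unfolding arithmetic_circuit_def fields
    by (intro conjI ballI acy) (assumption | rule reach lab)+
  then have "arithmetic_formula X C"
    unfolding arithmetic_formula_def fields by (intro conjI ballI impI sz)
  moreover have "monotone_circuit C"
    unfolding monotone_circuit_def fields
  proof (intro ballI allI impI)
    fix v q assume v: "v \<in> {a..Suc c}" "label_of C v = Const q"
    from v(1) N consider "v \<in> {a..b}" | "v \<in> {Suc b..c}" | "v = Suc c" by blast
    then show "0 \<le> q"
    proof cases
      case 1
      with v(2) A1(2,6) P1(2)[OF 1] show ?thesis by (simp add: monotone_circuit_def)
    next
      case 2
      with v(2) A2(2,6) P2(2)[OF 2] show ?thesis by (simp add: monotone_circuit_def)
    next
      case 3
      with v(2) l show ?thesis by (auto simp: C_def)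
    qed
  qed
  ultimately show "interval_formula X a (Suc c) C"
    using incr by (simp add: interval_formula_def fields)
  have "card (edges C) \<le> card (edges C1 \<union> edges C2) + card {(b, Suc c), (c, Suc c)}"
    unfolding E by (rule card_Un_le)
  also have "\<dots> \<le> card (edges C1) + card (edges C2) + 2"
    by (intro add_mono card_Un_le) (simp add: card_insert_if)
  finally show "circuit_size C \<le> circuit_size C1 + circuit_size C2 + 2"
    by (simp add: circuit_size_def)
  show "node_computes C b p" if "computes C1 p"
  proof (rule node_computes_transfer)
    show "node_computes C1 b p" using that unfolding computes_def A1(3) .
    show "b \<in> {a..b}" using A1(4) by simp
    show "label_of C v = label_of C1 v \<and> preds C v = preds C1 v \<and> preds C1 v \<subseteq> {a..b}"
      if "v \<in> {a..b}" for v using P1[OF that] by (intro conjI)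
  qed
  show "node_computes C c p" if "computes C2 p"
  proof (rule node_computes_transfer)
    show "node_computes C2 c p" using that unfolding computes_def A2(3) .
    show "c \<in> {Suc b..c}" using A2(4) by simp
    show "label_of C v = label_of C2 v \<and> preds C v = preds C2 v \<and> preds C2 v \<subseteq> {Suc b..c}"
      if "v \<in> {Suc b..c}" for v using P2[OF that] by (intro conjI)
  qed
qed

text \<open>A binary tree with l leaves has 2l - 2 edges. The left end \<open>a\<close> is arbitrary
  so that the second subformula can start right after the first.\<close>

lemma bform_to_interval_formula:
  assumes "monotone_form f" "vars_of f \<subseteq> X"
  shows "\<exists>b C. interval_formula X a b C \<and> computes C (value_of f) \<and> circuit_size C \<le> 2 * leaves f - 2"
  using assms
proof (induction f arbitrary: a)
  case (FVar x)
  show ?case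
    by (rule exI[of _ a], rule exI[of _ "\<lparr>nodes = {a}, edges = {}, label_of = (\<lambda>_. Var x), root = a\<rparr>"])
      (use FVar in \<open>auto simp: interval_formula_def arithmetic_formula_def arithmetic_circuit_def
        preds_def monotone_circuit_def computes_def circuit_size_def acyclic_def intro: node_computes.intros\<close>)
next
  case (FConst c)
  show ?case
    by (rule exI[of _ a], rule exI[of _ "\<lparr>nodes = {a}, edges = {}, label_of = (\<lambda>_. Const c), root = a\<rparr>"])
      (use FConst in \<open>auto simp: interval_formula_def arithmetic_formula_def arithmetic_circuit_def
        preds_def monotone_circuit_def computes_def circuit_size_def acyclic_def intro: node_computes.intros\<close>)
next
  case (FAdd f g)
  from FAdd.IH(1)[of a] FAdd.prems obtain b C1 where C1: "interval_formula X a b C1" "computes C1 (value_of f)"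
    "circuit_size C1 \<le> 2 * leaves f - 2" by auto
  from FAdd.IH(2)[of "Suc b"] FAdd.prems obtain c C2 where C2: "interval_formula X (Suc b) c C2" "computes C2 (value_of g)"
    "circuit_size C2 \<le> 2 * leaves g - 2" by auto
  define C where "C = \<lparr>nodes = {a..Suc c}, edges = edges C1 \<union> edges C2 \<union> {(b, Suc c), (c, Suc c)},
      label_of = (\<lambda>v. if v = Suc c then Plus else if v \<le> b then label_of C1 v else label_of C2 v),
      root = Suc c\<rparr>"
  note comb = interval_formula_combine[OF C1(1) C2(1), of Plus, folded C_def, simplified]
  have "node_computes C (Suc c) (\<Sum>u\<in>preds C (Suc c). if u = b then value_of f else value_of g)"
    using comb(3)[OF C1(2)] comb(4)[OF C2(2)]
    by (intro node_computes.intros(3)) (auto simp: comb(5), simp add: C_def)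
  also have "(\<Sum>u\<in>preds C (Suc c). if u = b then value_of f else value_of g) = value_of (FAdd f g)"
    using comb(6) by (simp add: comb(5))
  finally have "computes C (value_of (FAdd f g))" by (simp add: computes_def C_def)
  moreover have "circuit_size C \<le> 2 * leaves (FAdd f g) - 2"
    using comb(2) C1(3) C2(3) leaves_pos[of f] leaves_pos[of g] by simp
  ultimately show ?case using comb(1) by blast
next
  case (FMul f g)
  from FMul.IH(1)[of a] FMul.prems obtain b C1 where C1: "interval_formula X a b C1" "computes C1 (value_of f)"
    "circuit_size C1 \<le> 2 * leaves f - 2" by auto
  from FMul.IH(2)[of "Suc b"] FMul.prems obtain c C2 where C2: "interval_formula X (Suc b) c C2" "computes C2 (value_of g)"
    "circuit_size C2 \<le> 2 * leaves g - 2" by auto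
  define C where "C = \<lparr>nodes = {a..Suc c}, edges = edges C1 \<union> edges C2 \<union> {(b, Suc c), (c, Suc c)},
      label_of = (\<lambda>v. if v = Suc c then Times else if v \<le> b then label_of C1 v else label_of C2 v),
      root = Suc c\<rparr>"
  note comb = interval_formula_combine[OF C1(1) C2(1), of Times, folded C_def, simplified]
  have "node_computes C (Suc c) (\<Prod>u\<in>preds C (Suc c). if u = b then value_of f else value_of g)"
    using comb(3)[OF C1(2)] comb(4)[OF C2(2)]
    by (intro node_computes.intros(4)) (auto simp: comb(5), simp add: C_def)
  also have "(\<Prod>u\<in>preds C (Suc c). if u = b then value_of f else value_of g) = value_of (FMul f g)"
    using comb(6) by (simp add: comb(5))
  finally have "computes C (value_of (FMul f g))" by (simp add: computes_def C_def)
  moreover have "circuit_size C \<le> 2 * leaves (FMul f g) - 2"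
    using comb(2) C1(3) C2(3) leaves_pos[of f] leaves_pos[of g] by simp
  ultimately show ?case using comb(1) by blast
qed

lemma min_size_le_leaves:
  assumes "monotone_form f" "vars_of f \<subseteq> X"
  shows "min_monotone_formula_size X (value_of f) \<le> 2 * leaves f"
proof -
  obtain b C where C: "interval_formula X 0 b C" "computes C (value_of f)"
    "circuit_size C \<le> 2 * leaves f - 2"
    using bform_to_interval_formula[OF assms] by blast
  have "min_monotone_formula_size X (value_of f) \<le> circuit_size C"
    unfolding min_monotone_formula_size_def
    by (rule Least_le) (use C in \<open>auto simp: interval_formula_def\<close>)
  with C show ?thesis by simp
qed

text \<open>The \<open>LEAST\<close> in the minimum is attained once some circuit exists, and
  \<open>f\<close> supplies one. The formula \<open>g\<close> unfolds an optimal circuit and may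
  differ from \<open>f\<close>.\<close>

lemma leaves_le_min_size:
  assumes "monotone_form f" "vars_of f \<subseteq> X"
  shows "\<exists>g. monotone_form g \<and> value_of g = value_of f \<and>
    leaves g \<le> min_monotone_formula_size X (value_of f) + 1"
proof -
  have "\<exists>C. arithmetic_formula X C \<and> monotone_circuit C \<and> computes C (value_of f) \<and>
      circuit_size C = min_monotone_formula_size X (value_of f)"
    unfolding min_monotone_formula_size_def
    by (rule LeastI_ex)
      (use bform_to_interval_formula[OF assms, of 0] in \<open>auto simp: interval_formula_def\<close>)
  then show ?thesis using circuit_to_bform by metis
qed

section \<open>Lower bound\<close>

text \<open>The monomial contributed by the edges in A under \<open>\<phi>\<close>, with
  multiplicity when several edges have the same image.\<close>

definition image_mono :: "'a set set \<Rightarrow> ('a \<Rightarrow> 'b) \<Rightarrow> 'b set multiset" where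
  "image_mono A \<phi> = image_mset ((`) \<phi>) (mset_set A)"

lemma size_image_mono [simp]: "size (image_mono A \<phi>) = card A"
  by (simp add: image_mono_def)

lemma image_mono_empty [simp]: "image_mono {} \<phi> = {#}"
  by (simp add: image_mono_def)

lemma image_mono_Un:
  "finite A \<Longrightarrow> finite B \<Longrightarrow> A \<inter> B = {} \<Longrightarrow> image_mono (A \<union> B) \<phi> = image_mono A \<phi> + image_mono B \<phi>"
  by (simp add: image_mono_def mset_set_Union)

text \<open>A factor of the monomial is the image of a sub-multiset of \<open>mset_set A\<close>,
  where every multiplicity is at most 1, hence of a subset of A. The subset need not be unique when
  \<open>\<phi>\<close> identifies edges.\<close>

lemma image_mono_split:
  assumes "finite A" "image_mono A \<phi> = a + b"
  shows "\<exists>A'\<subseteq>A. a = image_mono A' \<phi> \<and> b = image_mono (A - A') \<phi>"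
proof -
  obtain M N where MN: "mset_set A = M + N" "a = image_mset ((`) \<phi>) M" "b = image_mset ((`) \<phi>) N"
    using image_mset_eq_plusD[of "(`) \<phi>" "mset_set A" a b] assms(2) by (auto simp: image_mono_def)
  have sub: "set_mset M \<subseteq> A"
    using arg_cong[OF MN(1), of set_mset] assms(1) by auto
  have "count M x + count N x = (if x \<in> A then 1 else 0)" for x
    using arg_cong[OF MN(1), of "\<lambda>K. count K x"] assms(1) by (simp add: count_mset_set')
  then have cnt: "count M x \<le> 1" for x by (metis le_add1 le_trans zero_le_one order_refl)
  have M: "M = mset_set (set_mset M)"
  proof (rule multiset_eqI)
    fix x
    show "count M x = count (mset_set (set_mset M)) x"
      using cnt[of x] by (cases "x \<in># M") (auto simp: count_mset_set' not_in_iff Suc_le_eq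
        intro: le_antisym)
  qed
  have "mset_set A = mset_set (set_mset M) + mset_set (A - set_mset M)"
    using assms(1) sub mset_set_Union[of "set_mset M" "A - set_mset M"]
    by (simp add: Un_absorb1)
  with MN(1) M have "N = mset_set (A - set_mset M)" by (metis add_left_cancel)
  with M MN sub show ?thesis by (metis image_mono_def)
qed

text \<open>\<open>D i\<close> is the class of target vertices reserved for vertex i. Since the
  edges cover V, the monomial of a map sees the image of every vertex.\<close>

locale coloured_graph =
  fixes V :: "'a set" and E :: "'a set set" and D :: "'a \<Rightarrow> 'b set" and m :: nat
  assumes graph: "simple_graph V E" and cover: "\<Union>E = V"
    and card_D: "\<And>i. i \<in> V \<Longrightarrow> card (D i) = m" and m_pos: "m > 0"
    and disjoint_D: "\<And>i j. i \<in> V \<Longrightarrow> j \<in> V \<Longrightarrow> D i \<inter> D j \<noteq> {} \<Longrightarrow> i = j"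
begin

lemma finite_V: "finite V" and finite_E: "finite E" and card_edge: "e \<in> E \<Longrightarrow> card e = 2"
proof -
  show "finite V" using graph by (simp add: simple_graph_def)
  moreover have "E \<subseteq> Pow V" using graph by (auto simp: simple_graph_def)
  ultimately show "finite E" by (meson finite_Pow_iff finite_subset)
  show "e \<in> E \<Longrightarrow> card e = 2" using graph by (simp add: simple_graph_def)
qed

lemma finite_D: "i \<in> V \<Longrightarrow> finite (D i)"
  using card_D[of i] m_pos card.infinite by fastforce

definition boundary :: "'a set set \<Rightarrow> 'a set" where
  "boundary A = \<Union>A \<inter> \<Union>(E - A)"

text \<open>The spliced monomial has one edge of every colour pair, so composing \<open>h\<close> with the colouring
  is a surjection, hence a bijection, of \<open>V\<close>: each vertex has a unique image of its own colour.\<close>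

lemma splice_agree:
  assumes \<phi>: "\<phi> \<in> PiE V D" and \<psi>: "\<psi> \<in> PiE V D" and "A \<subseteq> E"
    and eq: "image_mono A \<phi> + image_mono (E - A) \<psi> = image_mono E h"
    and i: "i \<in> boundary A"
  shows "\<phi> i = \<psi> i"
proof -
  have fin: "finite A" "finite (E - A)" using finite_E assms(3) finite_subset by auto
  have sets: "(`) \<phi> ` A \<union> (`) \<psi> ` (E - A) = (`) h ` E"
    using arg_cong[OF eq, of set_mset] fin finite_E by (simp add: image_mono_def)
  \<comment> \<open>The colour of a target vertex. A value of \<open>h\<close> outside all classes
    gets an unspecified colour, which does no harm: all of V is hit anyway, and counting then gives
    injectivity.\<close>
  define \<pi> where "\<pi> v = (THE i. i \<in> V \<and> v \<in> D i)" for v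
  have \<pi>: "\<pi> v = j" if "j \<in> V" "v \<in> D j" for v j
    unfolding \<pi>_def using that disjoint_D by (intro the_equality) blast+
  have EV: "e \<subseteq> V" if "e \<in> E" for e using cover that by blast
  have pre: "\<exists>k\<in>V. h k = \<chi> j \<and> \<pi> (h k) = j"
    if \<chi>: "\<chi> \<in> PiE V D" "j \<in> e" "e \<in> E" "\<chi> ` e \<in> (`) h ` E" for \<chi> j e
  proof -
    obtain f where f: "f \<in> E" "\<chi> ` e = h ` f" using \<chi>(4) by (elim imageE)
    have "\<chi> j \<in> h ` f" using imageI[OF \<chi>(2), of \<chi>] f(2) by simp
    then obtain k where k: "k \<in> f" "\<chi> j = h k" by (elim imageE)
    have "j \<in> V" using EV[OF \<chi>(3)] \<chi>(2) by blast
    then have "\<pi> (\<chi> j) = j" using \<pi> PiE_mem[OF \<chi>(1)] by blast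
    then show ?thesis using EV[OF f(1)] k by auto
  qed
  have preA: "\<exists>k\<in>V. h k = \<phi> j \<and> \<pi> (h k) = j" if "j \<in> e" "e \<in> A" for j e
    by (rule pre[OF \<phi> that(1)]) (use that sets assms(3) in blast)+
  have preB: "\<exists>k\<in>V. h k = \<psi> j \<and> \<pi> (h k) = j" if "j \<in> e" "e \<in> E - A" for j e
    by (rule pre[OF \<psi> that(1)]) (use that sets in blast)+
  have "j \<in> (\<pi> \<circ> h) ` V" if j: "j \<in> V" for j
  proof -
    obtain e where "e \<in> E" "j \<in> e" using j cover by blast
    with preA[of j e] preB[of j e] show ?thesis by (cases "e \<in> A") force+
  qed
  then have "card V \<le> card ((\<pi> \<circ> h) ` V)"
    using finite_V by (intro card_mono) auto
  then have inj: "inj_on (\<pi> \<circ> h) V"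
    using finite_V by (intro eq_card_imp_inj_on) (auto intro: le_antisym card_image_le)
  \<comment> \<open>An edge in A shows \<open>\<phi> i\<close> among the values of \<open>h\<close>,
    an edge outside A shows \<open>\<psi> i\<close>. Both have colour i, so injectivity identifies
    them.\<close>
  obtain e e' where "i \<in> e" "e \<in> A" "i \<in> e'" "e' \<in> E - A"
    using i by (auto simp: boundary_def)
  with preA preB obtain k k' where "k \<in> V" "k' \<in> V" "h k = \<phi> i" "h k' = \<psi> i"
    "\<pi> (h k) = i" "\<pi> (h k') = i" by metis
  with inj show ?thesis by (metis comp_apply inj_onD)
qed

text \<open>Members of the family are determined by their values outside B, where each vertex has m
  choices. The bound is multiplied out to avoid a difference of exponents.\<close>

lemma card_agreeing:
  assumes "\<Phi> \<subseteq> PiE V D" "B \<subseteq> V" "\<And>\<phi> \<psi> i. \<phi> \<in> \<Phi> \<Longrightarrow> \<psi> \<in> \<Phi> \<Longrightarrow> i \<in> B \<Longrightarrow> \<phi> i = \<psi> i"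
  shows "card \<Phi> * m ^ card B \<le> m ^ card V"
proof -
  have "inj_on (\<lambda>\<phi>. restrict \<phi> (V - B)) \<Phi>"
  proof (rule inj_onI)
    fix \<phi> \<psi> assume *: "\<phi> \<in> \<Phi>" "\<psi> \<in> \<Phi>" "restrict \<phi> (V - B) = restrict \<psi> (V - B)"
    show "\<phi> = \<psi>"
    proof (rule PiE_ext)
      show "\<phi> \<in> PiE V D" "\<psi> \<in> PiE V D" using * assms(1) by auto
      show "\<phi> i = \<psi> i" if "i \<in> V" for i
        using assms(3)[OF *(1,2), of i] fun_cong[OF *(3), of i] that by (cases "i \<in> B") auto
    qed
  qed
  moreover have "(\<lambda>\<phi>. restrict \<phi> (V - B)) ` \<Phi> \<subseteq> PiE (V - B) D"
    using assms(1) by (intro image_subsetI restrict_PiE_iff[THEN iffD2] ballI) blast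
  moreover have "finite (PiE (V - B) D)"
    using finite_V finite_D by (intro finite_PiE) auto
  ultimately have "card \<Phi> \<le> card (PiE (V - B) D)" by (metis card_image card_mono)
  also have "\<dots> = m ^ card (V - B)"
    using finite_V card_D by (simp add: card_PiE)
  finally have "card \<Phi> * m ^ card B \<le> m ^ card (V - B) * m ^ card B" by simp
  also have "\<dots> = m ^ card V"
    using finite_V assms(2) by (simp add: card_Diff_subset finite_subset card_mono flip: power_add)
  finally show ?thesis .
qed

text \<open>The shape in which leaves of the formula are settled: b is the exponent claimed by the
  induction, and q absorbs the constants.\<close>

lemma card_agreeing_weak:
  assumes "\<Phi> \<subseteq> PiE V D" "B' \<subseteq> V" "\<And>\<phi> \<psi> i. \<phi> \<in> \<Phi> \<Longrightarrow> \<psi> \<in> \<Phi> \<Longrightarrow> i \<in> B' \<Longrightarrow> \<phi> i = \<psi> i"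
    and "b \<le> card B'" "0 < q"
  shows "card \<Phi> * m ^ b \<le> q * m ^ card V"
proof -
  have "card \<Phi> * m ^ b \<le> card \<Phi> * m ^ card B'"
    using assms(4) m_pos by (intro mult_left_mono power_increasing) auto
  also have "\<dots> \<le> m ^ card V" using assms by (intro card_agreeing) auto
  also have "\<dots> \<le> q * m ^ card V" using assms(5) by simp
  finally show ?thesis .
qed

text \<open>\<open>R\<close> collects the monomials by which the context of \<open>g\<close> in the whole formula multiplies the
  monomials of \<open>g\<close>. At a product gate all members of \<open>\<Phi>\<close> split \<open>A\<close> into parts of the same sizes, since
  every monomial has degree \<open>card E\<close>; only a proper split costs a factor \<open>2 ^ card E\<close>.\<close>

lemma card_family_le_leaves:
  assumes "\<Phi> \<subseteq> PiE V D" "A \<subseteq> E" "B \<subseteq> V"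
    and "\<And>\<phi>. \<phi> \<in> \<Phi> \<Longrightarrow> image_mono A \<phi> \<in> monomials g"
    and "\<And>\<phi>. \<phi> \<in> \<Phi> \<Longrightarrow> image_mono (E - A) \<phi> \<in> R"
    and "\<And>r a. r \<in> R \<Longrightarrow> a \<in> monomials g \<Longrightarrow> \<exists>h. r + a = image_mono E h"
    and "boundary A \<subseteq> B"
    and "\<And>\<phi> \<psi> i. \<phi> \<in> \<Phi> \<Longrightarrow> \<psi> \<in> \<Phi> \<Longrightarrow> i \<in> B \<Longrightarrow> \<phi> i = \<psi> i"
  shows "card \<Phi> * m ^ (card B + set_treedepth E (\<Union>A - B)) \<le>
    leaves g * (2 ^ card E) ^ card A * m ^ card V"
  using assms
proof (induction g arbitrary: \<Phi> A B R)
  case (FVar x)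
  show ?case
  proof (cases "\<Phi> = {}")
    case False
    then obtain \<phi>0 where "\<phi>0 \<in> \<Phi>" by auto
    then have "image_mono A \<phi>0 = {#x#}" using FVar.prems(4) by simp
    then have "card A = 1" by (metis size_image_mono size_single)
    then obtain e where A: "A = {e}" by (auto simp: card_1_singleton_iff)
    have eV: "e \<subseteq> V" using A FVar.prems(2) cover by blast
    \<comment> \<open>All members map e onto the same variable, and the disjoint classes tell which
      end went where. So a variable leaf fixes both ends of e.\<close>
    have x: "\<phi> ` e = x" if "\<phi> \<in> \<Phi>" for \<phi>
      using FVar.prems(4)[OF that] A by (simp add: image_mono_def)
    have "\<phi> i = \<psi> i" if "\<phi> \<in> \<Phi>" "\<psi> \<in> \<Phi>" "i \<in> B \<union> e" for \<phi> \<psi> i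
    proof (cases "i \<in> B")
      case True
      then show ?thesis using FVar.prems(8) that by blast
    next
      case False
      then have "i \<in> e" using that by blast
      moreover have "\<phi> ` e = \<psi> ` e" using x that by simp
      ultimately obtain j where j: "j \<in> e" "\<phi> i = \<psi> j" by blast
      then have "\<phi> i \<in> D i" "\<psi> j \<in> D j"
        using that FVar.prems(1) \<open>i \<in> e\<close> eV by (meson PiE_mem subsetD)+
      then have "i = j" using j \<open>i \<in> e\<close> eV disjoint_D[of i j] by auto
      with j show ?thesis by simp
    qed
    moreover have "card B + set_treedepth E (\<Union>A - B) \<le> card (B \<union> e)"
    proof -
      have fin: "finite B" "finite e" using FVar.prems(3) eV finite_V finite_subset by auto
      then have "set_treedepth E (e - B) \<le> card (e - B)"
        by (intro set_treedepth_le treedepth_le_card) auto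
      moreover have "card (B \<union> e) = card B + card (e - B)"
        using card_Un_disjoint[of B "e - B"] fin by auto
      ultimately show ?thesis by (simp add: A)
    qed
    ultimately show ?thesis
      using FVar.prems(1,3) eV
      by (intro card_agreeing_weak[of \<Phi> "B \<union> e"]) auto
  qed simp
next
  case (FConst c)
  show ?case
  proof (cases "\<Phi> = {}")
    case False
    then obtain \<phi>0 where "\<phi>0 \<in> \<Phi>" by auto
    then have "image_mono A \<phi>0 = {#}" using FConst.prems(4)[of \<phi>0] by (auto split: if_splits)
    then have "card A = 0" by (metis size_image_mono size_empty)
    then have A: "A = {}" using finite_subset[OF FConst.prems(2) finite_E] by simp
    have "set_treedepth E (\<Union>A - B) = 0"
      using set_treedepth_le[OF treedepth_le.empty[of E 0]] A by simp
    then show ?thesis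
      using FConst.prems(1,3,8) by (intro card_agreeing_weak[of \<Phi> B]) auto
  qed simp
next
  case (FAdd g1 g2)
  define \<Phi>1 where "\<Phi>1 = {\<phi> \<in> \<Phi>. image_mono A \<phi> \<in> monomials g1}"
  define \<Phi>2 where "\<Phi>2 = {\<phi> \<in> \<Phi>. image_mono A \<phi> \<in> monomials g2}"
  let ?M = "m ^ (card B + set_treedepth E (\<Union>A - B))"
  have "\<Phi> = \<Phi>1 \<union> \<Phi>2" using FAdd.prems(4) by (auto simp: \<Phi>1_def \<Phi>2_def)
  then have "card \<Phi> * ?M \<le> card \<Phi>1 * ?M + card \<Phi>2 * ?M"
    using card_Un_le[of \<Phi>1 \<Phi>2] by (metis add_mult_distrib mult_le_mono1)
  also have "card \<Phi>1 * ?M \<le> leaves g1 * (2 ^ card E) ^ card A * m ^ card V"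
    by (rule FAdd.IH(1)[where R = R]) (use FAdd.prems in \<open>auto simp: \<Phi>1_def\<close>)
  also have "card \<Phi>2 * ?M \<le> leaves g2 * (2 ^ card E) ^ card A * m ^ card V"
    by (rule FAdd.IH(2)[where R = R]) (use FAdd.prems in \<open>auto simp: \<Phi>2_def\<close>)
  finally show ?case by (simp add: algebra_simps)
next
  case (FMul g1 g2)
  note prems = FMul.prems
  have finA: "finite A" using prems(2) finite_E finite_subset by blast
  have "\<exists>A'. A' \<subseteq> A \<and> image_mono A' \<phi> \<in> monomials g1 \<and> image_mono (A - A') \<phi> \<in> monomials g2"
    if "\<phi> \<in> \<Phi>" for \<phi>
  proof -
    obtain a b where "image_mono A \<phi> = a + b" "a \<in> monomials g1" "b \<in> monomials g2"
      using prems(4)[OF \<open>\<phi> \<in> \<Phi>\<close>] by auto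
    with image_mono_split[OF finA this(1)] show ?thesis by auto
  qed
  \<comment> \<open>\<open>s \<phi>\<close> is one choice of the edges that a parse tree for
    \<open>\<phi>\<close> sends to the first factor.\<close>
  then obtain s where s: "\<And>\<phi>. \<phi> \<in> \<Phi> \<Longrightarrow> s \<phi> \<subseteq> A \<and> image_mono (s \<phi>) \<phi> \<in> monomials g1 \<and>
      image_mono (A - s \<phi>) \<phi> \<in> monomials g2"
    by metis
  have glue: "\<exists>h. r + (a + b) = image_mono E h"
    if "r \<in> R" "a \<in> monomials g1" "b \<in> monomials g2" for r a b
    using prems(6)[OF that(1), of "a + b"] that by auto
  \<comment> \<open>The first part of \<open>\<phi>\<close>, the second part of
    \<open>\<psi>\<close> and the context of \<open>\<phi>\<close> together form a monomial of
    degree \<open>card E\<close>. Comparing degrees gives equal sizes.\<close>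
  have homog: "card (s \<phi>) = card (s \<psi>)" if mem: "\<phi> \<in> \<Phi>" "\<psi> \<in> \<Phi>" for \<phi> \<psi>
  proof -
    obtain h where "image_mono (E - A) \<phi> + (image_mono (s \<phi>) \<phi> + image_mono (A - s \<psi>) \<psi>) =
        image_mono E h"
      using glue[OF prems(5)[OF mem(1)]] s[OF mem(1)] s[OF mem(2)] by blast
    then have "card (E - A) + (card (s \<phi>) + card (A - s \<psi>)) = card E"
      by (metis size_image_mono size_union)
    moreover have "card (E - A) + card A = card E"
      using prems(2) finA finite_E by (simp add: card_Diff_subset card_mono)
    moreover have "card (A - s \<psi>) + card (s \<psi>) = card A"
      using s[OF mem(2)] finA by (metis card_Diff_subset card_mono finite_subset le_add_diff_inverse2)
    ultimately show ?thesis by linarith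
  qed
  \<comment> \<open>Seen from one factor, the other factor belongs to the context.\<close>
  define R1 where "R1 = {r + b | r b. r \<in> R \<and> b \<in> monomials g2}"
  define R2 where "R2 = {r + a | r a. r \<in> R \<and> a \<in> monomials g1}"
  have glue1: "\<exists>h. r + a = image_mono E h" if "r \<in> R1" "a \<in> monomials g1" for r a
  proof -
    from that(1) obtain r' b where "r = r' + b" "r' \<in> R" "b \<in> monomials g2"
      by (auto simp: R1_def)
    moreover have "r' + b + a = r' + (a + b)" by (simp add: ac_simps)
    ultimately show ?thesis using glue[of r' a b] that(2) by metis
  qed
  have glue2: "\<exists>h. r + b = image_mono E h" if "r \<in> R2" "b \<in> monomials g2" for r b
  proof -
    from that(1) obtain r' a where "r = r' + a" "r' \<in> R" "a \<in> monomials g1"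
      by (auto simp: R2_def)
    then show ?thesis using glue[of r' a b] that(2) by (simp add: add.assoc)
  qed
  let ?M = "m ^ (card B + set_treedepth E (\<Union>A - B))"
  consider "\<Phi> = {}" | \<phi>0 where "\<phi>0 \<in> \<Phi>" "s \<phi>0 = {}" | \<phi>0 where "\<phi>0 \<in> \<Phi>" "s \<phi>0 = A"
    | \<phi>0 where "\<phi>0 \<in> \<Phi>" "\<And>\<phi>. \<phi> \<in> \<Phi> \<Longrightarrow> s \<phi> \<noteq> {} \<and> s \<phi> \<noteq> A"
    by blast
  then show ?case
  proof cases
    case 1
    then show ?thesis by simp
  next
    case 2
    have s0: "s \<phi> = {}" if "\<phi> \<in> \<Phi>" for \<phi>
      using homog[OF that 2(1)] 2(2) s[OF that] finA finite_subset by fastforce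
    have "image_mono (E - A) \<phi> \<in> R2" if "\<phi> \<in> \<Phi>" for \<phi>
      unfolding R2_def using prems(5)[OF that] s[OF that] s0[OF that] by force
    moreover have "image_mono A \<phi> \<in> monomials g2" if "\<phi> \<in> \<Phi>" for \<phi>
      using s[OF that] s0[OF that] by simp
    ultimately have "card \<Phi> * ?M \<le> leaves g2 * (2 ^ card E) ^ card A * m ^ card V"
      using glue2 prems(8) by (intro FMul.IH(2)[OF prems(1-3) _ _ _ prems(7), where R = R2]) blast+
    then show ?thesis by (simp add: algebra_simps)
  next
    case 3
    have s0: "s \<phi> = A" if "\<phi> \<in> \<Phi>" for \<phi>
      using homog[OF that 3(1)] 3(2) s[OF that] finA by (metis card_subset_eq)
    have "image_mono (E - A) \<phi> \<in> R1" if "\<phi> \<in> \<Phi>" for \<phi>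
      unfolding R1_def using prems(5)[OF that] s[OF that] s0[OF that] by force
    moreover have "image_mono A \<phi> \<in> monomials g1" if "\<phi> \<in> \<Phi>" for \<phi>
      using s[OF that] s0[OF that] by simp
    ultimately have "card \<Phi> * ?M \<le> leaves g1 * (2 ^ card E) ^ card A * m ^ card V"
      using glue1 prems(8) by (intro FMul.IH(1)[OF prems(1-3) _ _ _ prems(7), where R = R1]) blast+
    then show ?thesis by (simp add: algebra_simps)
  next
    case 4
    let ?c = "2 ^ card E :: nat"
    let ?L = "leaves (FMul g1 g2) * ?c ^ (card A - 1) * m ^ card V"
    have part: "card {\<phi> \<in> \<Phi>. s \<phi> = A1} * ?M \<le> ?L" if "A1 \<subseteq> A" for A1
    proof (cases "A1 = {} \<or> A1 = A")
      case True
      with 4(2) have "{\<phi> \<in> \<Phi>. s \<phi> = A1} = {}" by auto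
      then show ?thesis by (simp only: card.empty mult_0 zero_le)
    next
      case False
      define \<Phi>' where "\<Phi>' = {\<phi> \<in> \<Phi>. s \<phi> = A1}"
      define A2 where "A2 = A - A1"
      \<comment> \<open>The vertices shared by the two parts and not fixed so far. They lie on the
        boundary of A1, so fixing the split makes all members of \<open>\<Phi>'\<close> agree on
        them.\<close>
      define W where "W = (\<Union>A1 \<inter> \<Union>A2) - B"
      define B' where "B' = B \<union> W"
      have fin: "finite A1" "finite A2" using finA that finite_subset by (auto simp: A2_def)
      have sub: "A1 \<subseteq> E" "A2 \<subseteq> E" using that prems(2) by (auto simp: A2_def)
      have un: "A = A1 \<union> A2" "E - A1 = (E - A) \<union> A2" "E - A2 = (E - A) \<union> A1"
        "(E - A) \<inter> A2 = {}" "(E - A) \<inter> A1 = {}"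
        using that prems(2) by (auto simp: A2_def)
      have cards: "card A1 \<le> card A - 1" "card A2 \<le> card A - 1"
      proof -
        have "A1 \<subset> A" "A2 \<subset> A" using False that by (auto simp: A2_def)
        then show "card A1 \<le> card A - 1" "card A2 \<le> card A - 1"
          using psubset_card_mono[OF finA, of A1] psubset_card_mono[OF finA, of A2] by linarith+
      qed
      have \<Phi>': "\<phi> \<in> \<Phi>" "image_mono A1 \<phi> \<in> monomials g1" "image_mono A2 \<phi> \<in> monomials g2"
        "image_mono (E - A1) \<phi> = image_mono (E - A) \<phi> + image_mono A2 \<phi>"
        "image_mono (E - A2) \<phi> = image_mono (E - A) \<phi> + image_mono A1 \<phi>"
        "image_mono (E - A) \<phi> \<in> R" if "\<phi> \<in> \<Phi>'" for \<phi>
        using s[of \<phi>] that fin finite_E prems(5)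
        unfolding \<Phi>'_def A2_def[symmetric] un(2,3)
        by (auto simp: A2_def intro!: image_mono_Un)
      have "W \<subseteq> boundary A1" using un by (auto simp: W_def boundary_def)
      have agree: "\<phi> i = \<psi> i" if mem: "\<phi> \<in> \<Phi>'" "\<psi> \<in> \<Phi>'" "i \<in> B'" for \<phi> \<psi> i
      proof (cases "i \<in> B")
        case True
        then show ?thesis using prems(8) \<Phi>'(1) that by blast
      next
        case False
        then have "i \<in> boundary A1" using that \<open>W \<subseteq> boundary A1\<close> by (auto simp: B'_def)
        \<comment> \<open>The exchange: \<open>\<phi>\<close> supplies the monomial of the first
          factor, \<open>\<psi>\<close> those of the second factor and of the context.\<close>
        moreover obtain h where
          "image_mono (E - A) \<psi> + (image_mono A1 \<phi> + image_mono A2 \<psi>) = image_mono E h"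
          using glue \<Phi>'(2)[OF mem(1)] \<Phi>'(3,6)[OF mem(2)] by blast
        then have "image_mono A1 \<phi> + image_mono (E - A1) \<psi> = image_mono E h"
          using \<Phi>'(4)[OF that(2)] by (simp add: ac_simps)
        moreover have "\<phi> \<in> PiE V D" "\<psi> \<in> PiE V D" using that \<Phi>'(1) prems(1) by blast+
        ultimately show ?thesis using splice_agree sub(1) by blast
      qed
      have bd: "boundary A1 \<subseteq> B'" "boundary A2 \<subseteq> B'"
        using prems(7) un by (auto simp: boundary_def B'_def W_def)
      have "W \<subseteq> V" using sub cover by (auto simp: W_def)
      then have B'V: "B' \<subseteq> V" using prems(3) by (auto simp: B'_def)
      have cB': "card B' = card B + card W"
        unfolding B'_def using \<open>W \<subseteq> V\<close> prems(3) finite_V finite_subset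
        by (intro card_Un_disjoint) (auto simp: W_def)
      have \<Phi>'V: "\<Phi>' \<subseteq> PiE V D" using prems(1) by (auto simp: \<Phi>'_def)
      have "card \<Phi>' * m ^ (card B' + set_treedepth E (\<Union>A1 - B')) \<le>
          leaves g1 * ?c ^ card A1 * m ^ card V"
      proof (rule FMul.IH(1)[where R = R1, OF \<Phi>'V sub(1) B'V _ _ _ bd(1)])
        fix \<phi> assume \<phi>: "\<phi> \<in> \<Phi>'"
        show "image_mono A1 \<phi> \<in> monomials g1" by (rule \<Phi>'(2)[OF \<phi>])
        show "image_mono (E - A1) \<phi> \<in> R1"
          unfolding R1_def \<Phi>'(4)[OF \<phi>] using \<Phi>'(2,3,6)[OF \<phi>] by blast
      next
        show "\<exists>h. r + a = image_mono E h" if "r \<in> R1" "a \<in> monomials g1" for r a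
          using that by (rule glue1)
        show "\<phi> i = \<psi> i" if "\<phi> \<in> \<Phi>'" "\<psi> \<in> \<Phi>'" "i \<in> B'" for \<phi> \<psi> i
          using that by (rule agree)
      qed
      also have "\<dots> \<le> ?L"
        using cards(1) by (intro mult_le_mono power_increasing order_refl) auto
      finally have le1: "card \<Phi>' * m ^ (card B' + set_treedepth E (\<Union>A1 - B')) \<le> ?L" .
      have "card \<Phi>' * m ^ (card B' + set_treedepth E (\<Union>A2 - B')) \<le>
          leaves g2 * ?c ^ card A2 * m ^ card V"
      proof (rule FMul.IH(2)[where R = R2, OF \<Phi>'V sub(2) B'V _ _ _ bd(2)])
        fix \<phi> assume \<phi>: "\<phi> \<in> \<Phi>'"
        show "image_mono A2 \<phi> \<in> monomials g2" by (rule \<Phi>'(3)[OF \<phi>])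
        show "image_mono (E - A2) \<phi> \<in> R2"
          unfolding R2_def \<Phi>'(5)[OF \<phi>] using \<Phi>'(2,3,6)[OF \<phi>] by blast
      next
        show "\<exists>h. r + a = image_mono E h" if "r \<in> R2" "a \<in> monomials g2" for r a
          using that by (rule glue2)
        show "\<phi> i = \<psi> i" if "\<phi> \<in> \<Phi>'" "\<psi> \<in> \<Phi>'" "i \<in> B'" for \<phi> \<psi> i
          using that by (rule agree)
      qed
      also have "\<dots> \<le> ?L"
        using cards(2) by (intro mult_le_mono power_increasing order_refl) auto
      finally have le2: "card \<Phi>' * m ^ (card B' + set_treedepth E (\<Union>A2 - B')) \<le> ?L" .
      \<comment> \<open>Once W is fixed, no edge of E joins the two sides: an edge in A1 would put
        its far end into both parts, and an edge outside A1 would put its near end on the boundary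
        of A1.\<close>
      have "set_treedepth E (\<Union>A - B) \<le>
          card W + max (set_treedepth E (\<Union>A1 - B')) (set_treedepth E (\<Union>A2 - B'))"
      proof (rule set_treedepth_separate)
        show "finite (\<Union>A - B)"
          using finite_V cover prems(2) by (meson Diff_subset Union_mono finite_subset subset_trans equalityD1)
        show "W \<subseteq> \<Union>A - B" "\<Union>A - B - W = (\<Union>A1 - B') \<union> (\<Union>A2 - B')"
          "(\<Union>A1 - B') \<inter> (\<Union>A2 - B') = {}"
          using un(1) by (auto simp: W_def B'_def)
        show "{u, v} \<notin> E" if uv: "u \<in> \<Union>A1 - B'" "v \<in> \<Union>A2 - B'" for u v
        proof
          assume "{u, v} \<in> E"
          show False
          proof (cases "{u, v} \<in> A1")
            case True
            then have "v \<in> B'" using uv(2) by (auto simp: B'_def W_def)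
            with uv show False by simp
          next
            case False
            then have "u \<in> boundary A1" using uv(1) \<open>{u, v} \<in> E\<close> by (auto simp: boundary_def)
            with bd uv show False by blast
          qed
        qed
      qed
      \<comment> \<open>One of the two factors carries at least the old exponent, and the bound for
        that factor alone suffices.\<close>
      then have "card B + set_treedepth E (\<Union>A - B) \<le> card B' + set_treedepth E (\<Union>A1 - B') \<or>
        card B + set_treedepth E (\<Union>A - B) \<le> card B' + set_treedepth E (\<Union>A2 - B')"
        unfolding cB' by linarith
      then have "?M \<le> m ^ (card B' + set_treedepth E (\<Union>A1 - B')) \<or>
          ?M \<le> m ^ (card B' + set_treedepth E (\<Union>A2 - B'))"
        using m_pos power_increasing[of _ _ m] by (metis One_nat_def Suc_leI)
      with le1 le2 have "card \<Phi>' * ?M \<le> ?L" by (meson le_trans mult_le_mono2)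
      then show ?thesis by (simp only: \<Phi>'_def)
    qed
    have "\<Phi> = (\<Union>A1\<in>Pow A. {\<phi> \<in> \<Phi>. s \<phi> = A1})" using s by blast
    then have "card \<Phi> \<le> (\<Sum>A1\<in>Pow A. card {\<phi> \<in> \<Phi>. s \<phi> = A1})"
      using card_UN_le[of "Pow A" "\<lambda>A1. {\<phi> \<in> \<Phi>. s \<phi> = A1}"] finA by simp
    then have "card \<Phi> * ?M \<le> (\<Sum>A1\<in>Pow A. card {\<phi> \<in> \<Phi>. s \<phi> = A1}) * ?M"
      by (rule mult_le_mono1)
    also have "\<dots> = (\<Sum>A1\<in>Pow A. card {\<phi> \<in> \<Phi>. s \<phi> = A1} * ?M)"
      by (rule sum_distrib_right)
    also have "\<dots> \<le> (\<Sum>A1\<in>Pow A. ?L)" using part by (intro sum_mono) blast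
    also have "\<dots> = 2 ^ card A * ?L" using finA by (simp add: card_Pow)
    also have "\<dots> \<le> ?c * ?L"
      using prems(2) finite_E by (intro mult_le_mono1 power_increasing card_mono) auto
    also have "\<dots> = leaves (FMul g1 g2) * ?c ^ card A * m ^ card V"
    proof -
      have "A \<noteq> {}" using 4 s by blast
      then have "card A = Suc (card A - 1)" using finA by (simp add: card_gt_0_iff)
      then have "?c ^ card A = ?c * ?c ^ (card A - 1)" by (metis power_Suc)
      then show ?thesis by (simp only: mult_ac)
    qed
    finally show ?thesis .
  qed
qed

text \<open>At the root A is E, nothing is fixed, the context is the empty monomial and the family
  consists of all \<open>m ^ card V\<close> maps, a factor that cancels. At most
  \<open>card E\<close> nested proper splits with at most \<open>2 ^ card E\<close> choices each
  make up the constant.\<close>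

lemma power_treedepth_le_leaves:
  assumes "\<And>a. a \<in> monomials g \<Longrightarrow> \<exists>h. a = image_mono E h"
    and "\<And>\<phi>. \<phi> \<in> PiE V D \<Longrightarrow> image_mono E \<phi> \<in> monomials g"
  shows "m ^ set_treedepth E V \<le> leaves g * (2 ^ card E) ^ card E"
proof -
  have "card (PiE V D) * m ^ (card ({} :: 'a set) + set_treedepth E (\<Union>E - {})) \<le>
      leaves g * (2 ^ card E) ^ card E * m ^ card V"
    by (rule card_family_le_leaves[where R = "{{#}}" and B = "{}"]) (use assms in \<open>auto simp: boundary_def\<close>)
  moreover have "card (PiE V D) = m ^ card V"
    using finite_V card_D by (simp add: card_PiE)
  ultimately have "m ^ card V * m ^ set_treedepth E V \<le> m ^ card V * (leaves g * (2 ^ card E) ^ card E)"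
    using cover by (simp add: mult_ac)
  then show ?thesis using m_pos by simp
qed

end

section \<open>Upper bound\<close>

text \<open>The value 0 on non-edges allows sums over all maps in place of homomorphisms.\<close>

definition edge_poly :: "'b set set \<Rightarrow> 'b set \<Rightarrow> 'b set mpoly" where
  "edge_poly F e = (if e \<in> F then var_poly e else 0)"

text \<open>The contribution of S when \<open>\<phi>\<close> gives the images of all other vertices:
  a sum over the placements of S, with only the edges that meet S. In an elimination tree
  \<open>\<phi>\<close> holds the images of the ancestors.\<close>

definition ext_poly :: "'a set set \<Rightarrow> 'b set \<Rightarrow> 'b set set \<Rightarrow> 'a set \<Rightarrow> ('a \<Rightarrow> 'b) \<Rightarrow> 'b set mpoly" where
  "ext_poly E W F S \<phi> =
     (\<Sum>\<psi>\<in>S \<rightarrow>\<^sub>E W. \<Prod>e\<in>{e \<in> E. e \<inter> S \<noteq> {}}. edge_poly F (override_on \<phi> \<psi> S ` e))"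

lemma ext_poly_empty [simp]: "ext_poly E W F {} \<phi> = 1"
  by (simp add: ext_poly_def)

text \<open>An edge is multiplied in once both ends are placed, that is, at the end eliminated
  later. For u these are the edges to vertices placed before; the edges from u into S are left to
  the factor for S, which knows the image v.\<close>

lemma ext_poly_insert:
  assumes "finite E" "finite W" "finite S" "u \<notin> S"
  shows "ext_poly E W F (insert u S) \<phi> = (\<Sum>v\<in>W.
    (\<Prod>e\<in>{e \<in> E. u \<in> e \<and> e \<inter> S = {}}. edge_poly F (\<phi>(u := v) ` e)) * ext_poly E W F S (\<phi>(u := v)))"
proof -
  let ?P = "\<lambda>\<psi>. \<Prod>e\<in>{e \<in> E. e \<inter> insert u S \<noteq> {}}. edge_poly F (override_on \<phi> \<psi> (insert u S) ` e)"
  have upd: "?P (\<psi>(u := v)) = (\<Prod>e\<in>{e \<in> E. u \<in> e \<and> e \<inter> S = {}}. edge_poly F (\<phi>(u := v) ` e)) *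
      (\<Prod>e\<in>{e \<in> E. e \<inter> S \<noteq> {}}. edge_poly F (override_on (\<phi>(u := v)) \<psi> S ` e))" for \<psi> v
  proof -
    have split: "{e \<in> E. e \<inter> insert u S \<noteq> {}} = {e \<in> E. u \<in> e \<and> e \<inter> S = {}} \<union> {e \<in> E. e \<inter> S \<noteq> {}}"
      by auto
    have ov: "override_on \<phi> (\<psi>(u := v)) (insert u S) = override_on (\<phi>(u := v)) \<psi> S"
      using assms(4) by (auto simp: override_on_def)
    have "override_on (\<phi>(u := v)) \<psi> S ` e = \<phi>(u := v) ` e" if "e \<inter> S = {}" for e
      by (rule image_cong) (use that in \<open>auto simp: override_on_def\<close>)
    then show ?thesis
      unfolding split ov using assms(1) by (subst prod.union_disjoint) auto
  qed
  have "ext_poly E W F (insert u S) \<phi> =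
      (\<Sum>\<psi>\<in>(\<lambda>(v, \<psi>). \<psi>(u := v)) ` (W \<times> (S \<rightarrow>\<^sub>E W)). ?P \<psi>)"
    by (simp add: ext_poly_def PiE_insert_eq)
  also have "\<dots> = sum (?P \<circ> (\<lambda>(v, \<psi>). \<psi>(u := v))) (W \<times> (S \<rightarrow>\<^sub>E W))"
    by (rule sum.reindex[OF inj_combinator[OF assms(4)]])
  also have "\<dots> = (\<Sum>(v, \<psi>)\<in>W \<times> (S \<rightarrow>\<^sub>E W). ?P (\<psi>(u := v)))"
    by (rule sum.cong) (simp_all only: comp_apply case_prod_beta)
  also have "\<dots> = (\<Sum>v\<in>W. \<Sum>\<psi>\<in>S \<rightarrow>\<^sub>E W. ?P (\<psi>(u := v)))"
    by (rule sum.cartesian_product[symmetric])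
  finally show ?thesis
    by (simp only: upd ext_poly_def sum_distrib_left)
qed

lemma ext_poly_cong:
  assumes "\<And>e i. e \<in> E \<Longrightarrow> e \<inter> S \<noteq> {} \<Longrightarrow> i \<in> e - S \<Longrightarrow> \<phi> i = \<phi>' i"
  shows "ext_poly E W F S \<phi> = ext_poly E W F S \<phi>'"
proof -
  have "override_on \<phi> \<psi> S ` e = override_on \<phi>' \<psi> S ` e" if "e \<in> E" "e \<inter> S \<noteq> {}" for \<psi> e
    by (rule image_cong) (use assms[OF that] in \<open>auto simp: override_on_def\<close>)
  then show ?thesis by (simp add: ext_poly_def)
qed

text \<open>No edge meets both S and T, so a placement of one side leaves the other factor
  untouched, and distributivity splits the sum.\<close>

lemma ext_poly_union:
  assumes "finite E" "finite W" "finite S" "finite T" "S \<inter> T = {}"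
    and "\<And>e. e \<in> E \<Longrightarrow> e \<inter> S = {} \<or> e \<inter> T = {}"
  shows "ext_poly E W F (S \<union> T) \<phi> = ext_poly E W F S \<phi> * ext_poly E W F T \<phi>"
  using assms(3,5,6)
proof (induction S arbitrary: \<phi> rule: finite_induct)
  case (insert u S)
  have edges: "{e \<in> E. u \<in> e \<and> e \<inter> (S \<union> T) = {}} = {e \<in> E. u \<in> e \<and> e \<inter> S = {}}"
    using insert.prems(2) by blast
  have IH: "ext_poly E W F (S \<union> T) \<phi>' = ext_poly E W F S \<phi>' * ext_poly E W F T \<phi>'" for \<phi>'
    using insert.prems by (intro insert.IH) blast+
  have T: "ext_poly E W F T (\<phi>(u := v)) = ext_poly E W F T \<phi>" for v
    by (rule ext_poly_cong) (use insert.prems(2) in auto)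
  have "ext_poly E W F (insert u (S \<union> T)) \<phi> = (\<Sum>v\<in>W.
      (\<Prod>e\<in>{e \<in> E. u \<in> e \<and> e \<inter> S = {}}. edge_poly F (\<phi>(u := v) ` e)) *
      (ext_poly E W F S (\<phi>(u := v)) * ext_poly E W F T \<phi>))"
    using insert.hyps insert.prems(1) assms
    by (subst ext_poly_insert) (auto simp: edges IH T)
  also have "\<dots> = ext_poly E W F (insert u S) \<phi> * ext_poly E W F T \<phi>"
    using insert.hyps assms by (simp add: ext_poly_insert sum_distrib_right mult.assoc)
  finally show ?case by simp
qed simp

text \<open>A map that is not a homomorphism contributes a zero factor. With all of V summed over,
  no edge reads the outer map, hence \<open>undefined\<close>.\<close>

lemma hom_poly_eq_ext_poly:
  assumes "simple_graph V E"
  shows "hom_poly V E n = ext_poly E {1..n} (complete_edges n) V undefined"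
proof -
  have fin: "finite V" "finite E"
    using assms finite_subset[of E "Pow V"] by (auto simp: simple_graph_def)
  have edge: "e \<subseteq> V" "\<exists>i j. e = {i, j}" if "e \<in> E" for e
    using assms that unfolding simple_graph_def card_2_iff by blast+
  have "e \<inter> V \<noteq> {}" if "e \<in> E" for e
    using edge(1)[OF that] edge(2)[OF that] by auto
  then have meet: "{e \<in> E. e \<inter> V \<noteq> {}} = E" by blast
  have ov: "override_on undefined \<psi> V ` e = \<psi> ` e" if "e \<in> E" for \<psi> :: "'a \<Rightarrow> nat" and e
    by (rule image_cong) (use edge[OF that] in \<open>auto simp: override_on_def\<close>)
  let ?H = "graph_homs V E {1..n} (complete_edges n)"
  have "ext_poly E {1..n} (complete_edges n) V undefined =
      (\<Sum>\<psi>\<in>V \<rightarrow>\<^sub>E {1..n}. \<Prod>e\<in>E. edge_poly (complete_edges n) (\<psi> ` e))"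
    by (simp add: ext_poly_def meet ov)
  also have "\<dots> = (\<Sum>\<psi>\<in>?H. \<Prod>e\<in>E. edge_poly (complete_edges n) (\<psi> ` e))"
  proof (rule sum.mono_neutral_right)
    show "finite (V \<rightarrow>\<^sub>E {1..n})" using fin by (intro finite_PiE) auto
    show "?H \<subseteq> V \<rightarrow>\<^sub>E {1..n}" by (auto simp: graph_homs_def)
    show "\<forall>\<psi>\<in>(V \<rightarrow>\<^sub>E {1..n}) - ?H. (\<Prod>e\<in>E. edge_poly (complete_edges n) (\<psi> ` e)) = 0"
    proof
      fix \<psi> assume "\<psi> \<in> (V \<rightarrow>\<^sub>E {1..n}) - ?H"
      then obtain i j where "{i, j} \<in> E" "{\<psi> i, \<psi> j} \<notin> complete_edges n"
        by (auto simp: graph_homs_def)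
      then show "(\<Prod>e\<in>E. edge_poly (complete_edges n) (\<psi> ` e)) = 0"
        using fin by (intro prod_zero) (auto simp: edge_poly_def intro!: bexI[of _ "{i, j}"])
    qed
  qed
  also have "\<dots> = hom_poly V E n"
    unfolding hom_poly_def
  proof (intro sum.cong prod.cong refl)
    fix \<psi> e assume "\<psi> \<in> ?H" "e \<in> E"
    moreover then obtain i j where "e = {i, j}" using edge(2) by blast
    ultimately show "edge_poly (complete_edges n) (\<psi> ` e) = var_poly (\<psi> ` e)"
      by (auto simp: graph_homs_def edge_poly_def)
  qed
  finally show ?thesis by simp
qed

lemma ex_edge_bform:
  "\<exists>f. monotone_form f \<and> vars_of f \<subseteq> F \<and> value_of f = edge_poly F e \<and> leaves f = 1"
proof (cases "e \<in> F")
  case True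
  then show ?thesis by (intro exI[of _ "FVar e"]) (auto simp: edge_poly_def)
next
  case False
  then show ?thesis by (intro exI[of _ "FConst 0"]) (auto simp: edge_poly_def)
qed

lemma ex_prod_edge_bform:
  assumes "finite A"
  shows "\<exists>f. monotone_form f \<and> vars_of f \<subseteq> F \<and> value_of f = (\<Prod>e\<in>A. edge_poly F (\<phi> ` e)) \<and>
    leaves f \<le> card A + 1"
proof -
  obtain G where "\<And>e. monotone_form (G e) \<and> vars_of (G e) \<subseteq> F \<and>
      value_of (G e) = edge_poly F (\<phi> ` e) \<and> leaves (G e) = 1"
    using choice[of "\<lambda>e f. monotone_form f \<and> vars_of f \<subseteq> F \<and>
      value_of f = edge_poly F (\<phi> ` e) \<and> leaves f = 1"] ex_edge_bform by blast
  then show ?thesis using ex_prod_bform[OF assms, of G F] by (auto split: if_splits)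
qed

text \<open>The formula for S depends on the images placed before, so removing a vertex costs
  \<open>card W\<close> copies of the rest, while separated parts are multiplied at the same
  exponent. The constant is chosen before W, F and \<open>\<phi>\<close>, which makes it uniform in
  n.\<close>

lemma ex_ext_poly_bform:
  assumes "treedepth_le E S d" "finite E" "\<And>e. e \<in> E \<Longrightarrow> card e = 2"
  shows "\<exists>c. \<forall>W F \<phi>. finite W \<longrightarrow> W \<noteq> {} \<longrightarrow> (\<exists>f. monotone_form f \<and> vars_of f \<subseteq> F \<and>
    value_of f = ext_poly E (W :: 'b set) F S \<phi> \<and> leaves f \<le> c * card W ^ d)"
  using assms(1)
proof (induction rule: treedepth_le.induct)
  case (empty d)
  show ?case
    by (intro exI[of _ 1] allI impI exI[of _ "FConst 1"]) (auto simp: Suc_le_eq card_gt_0_iff)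
next
  case (remove u S d)
  then obtain c where c: "\<And>W F \<phi>. finite W \<Longrightarrow> W \<noteq> {} \<Longrightarrow> \<exists>f. monotone_form f \<and> vars_of f \<subseteq> F \<and>
      value_of f = ext_poly E (W :: 'b set) F (S - {u}) \<phi> \<and> leaves f \<le> c * card W ^ d"
    by metis
  show ?case
  \<comment> \<open>\<open>card E + 1\<close> bounds the leaves spent on the edges at u; the 1
    covers an empty product.\<close>
  proof (intro exI[of _ "card E + 1 + c"] allI impI)
    fix W :: "'b set" and F \<phi> assume W: "finite W" "W \<noteq> {}"
    let ?A = "{e \<in> E. u \<in> e \<and> e \<inter> (S - {u}) = {}}"
    have "\<exists>f. monotone_form f \<and> vars_of f \<subseteq> F \<and>
      value_of f = (\<Prod>e\<in>?A. edge_poly F (\<phi>(u := v) ` e)) * ext_poly E W F (S - {u}) (\<phi>(u := v)) \<and>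
      leaves f \<le> card E + 1 + c * card W ^ d" for v
    proof -
      obtain f where f: "monotone_form f" "vars_of f \<subseteq> F"
        "value_of f = ext_poly E W F (S - {u}) (\<phi>(u := v))" "leaves f \<le> c * card W ^ d"
        using c[OF W] by blast
      obtain g where g: "monotone_form g" "vars_of g \<subseteq> F"
        "value_of g = (\<Prod>e\<in>?A. edge_poly F (\<phi>(u := v) ` e))" "leaves g \<le> card ?A + 1"
        using ex_prod_edge_bform[of ?A F "\<phi>(u := v)"] assms(2) by auto
      have "card ?A \<le> card E" using assms(2) by (intro card_mono) auto
      with f g show ?thesis by (intro exI[of _ "FMul g f"]) auto
    qed
    then obtain G where G: "\<And>v. monotone_form (G v) \<and> vars_of (G v) \<subseteq> F \<and>
      value_of (G v) = (\<Prod>e\<in>?A. edge_poly F (\<phi>(u := v) ` e)) * ext_poly E W F (S - {u}) (\<phi>(u := v)) \<and>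
      leaves (G v) \<le> card E + 1 + c * card W ^ d"
      by metis
    obtain f where f: "monotone_form f" "vars_of f \<subseteq> F" "value_of f = (\<Sum>v\<in>W. value_of (G v))"
      "leaves f \<le> (\<Sum>v\<in>W. leaves (G v))"
      using ex_sum_bform[OF W(1), of G F] G W(2) by auto
    have "finite (S - {u})" using remove.hyps(2) by (rule treedepth_le_finite)
    then have "value_of f = ext_poly E W F (insert u (S - {u})) \<phi>"
      unfolding f(3) using assms(2) W(1) G by (subst ext_poly_insert) auto
    then have val: "value_of f = ext_poly E W F S \<phi>"
      using remove.hyps(1) by (simp add: insert_absorb)
    have "leaves f \<le> (\<Sum>v\<in>W. card E + 1 + c * card W ^ d)"
      using f(4) G by (meson le_trans sum_mono)
    also have "\<dots> = card W * (card E + 1 + c * card W ^ d)" by simp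
    also have "\<dots> \<le> card W * ((card E + 1) * card W ^ d + c * card W ^ d)"
    proof -
      have "1 \<le> card W ^ d" using W by (simp add: Suc_le_eq card_gt_0_iff)
      then have "(card E + 1) * 1 \<le> (card E + 1) * card W ^ d" by (rule mult_left_mono) simp
      then show ?thesis by (intro mult_left_mono add_right_mono) simp_all
    qed
    also have "\<dots> = (card E + 1 + c) * card W ^ Suc d" by (simp add: algebra_simps)
    finally show "\<exists>f. monotone_form f \<and> vars_of f \<subseteq> F \<and> value_of f = ext_poly E W F S \<phi> \<and>
        leaves f \<le> (card E + 1 + c) * card W ^ Suc d"
      using f val by blast
  qed
next
  case (union S d T)
  from union.IH obtain c1 c2
    where c1: "\<And>W F \<phi>. finite W \<Longrightarrow> W \<noteq> {} \<Longrightarrow> \<exists>f. monotone_form f \<and> vars_of f \<subseteq> F \<and>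
      value_of f = ext_poly E (W :: 'b set) F S \<phi> \<and> leaves f \<le> c1 * card W ^ d"
    and c2: "\<And>W F \<phi>. finite W \<Longrightarrow> W \<noteq> {} \<Longrightarrow> \<exists>f. monotone_form f \<and> vars_of f \<subseteq> F \<and>
      value_of f = ext_poly E (W :: 'b set) F T \<phi> \<and> leaves f \<le> c2 * card W ^ d"
    by metis
  have sep: "e \<inter> S = {} \<or> e \<inter> T = {}" if "e \<in> E" for e
  proof (rule ccontr)
    assume "\<not> ?thesis"
    then obtain x y where xy: "x \<in> e" "x \<in> S" "y \<in> e" "y \<in> T" by blast
    then have "x \<noteq> y" using union.hyps(3) by blast
    with xy assms(3)[OF that] have "e = {x, y}" by (auto simp: card_2_iff)
    with union.hyps(4) xy that show False by blast
  qed
  show ?case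
  proof (intro exI[of _ "c1 + c2"] allI impI)
    fix W :: "'b set" and F \<phi> assume W: "finite W" "W \<noteq> {}"
    obtain f where f: "monotone_form f" "vars_of f \<subseteq> F"
      "value_of f = ext_poly E W F S \<phi>" "leaves f \<le> c1 * card W ^ d"
      using c1[OF W] by blast
    obtain g where g: "monotone_form g" "vars_of g \<subseteq> F"
      "value_of g = ext_poly E W F T \<phi>" "leaves g \<le> c2 * card W ^ d"
      using c2[OF W] by blast
    have "ext_poly E W F (S \<union> T) \<phi> = ext_poly E W F S \<phi> * ext_poly E W F T \<phi>"
      using assms(2) W(1) union.hyps(3) sep treedepth_le_finite[OF union.hyps(1)]
        treedepth_le_finite[OF union.hyps(2)]
      by (intro ext_poly_union) auto
    with f g show "\<exists>f. monotone_form f \<and> vars_of f \<subseteq> F \<and>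
      value_of f = ext_poly E W F (S \<union> T) \<phi> \<and> leaves f \<le> (c1 + c2) * card W ^ d"
      by (intro exI[of _ "FMul f g"]) (auto simp: add_mult_distrib)
  qed
qed

lemma ex_hom_poly_bform:
  assumes "simple_graph V E"
  shows "\<exists>c. \<forall>n\<ge>1. \<exists>f. monotone_form f \<and> vars_of f \<subseteq> complete_edges n \<and>
    value_of f = hom_poly V E n \<and> leaves f \<le> c * n ^ set_treedepth E V"
proof -
  have fin: "finite V" "finite E" "\<And>e. e \<in> E \<Longrightarrow> card e = 2"
    using assms finite_subset[of E "Pow V"] by (auto simp: simple_graph_def)
  obtain c where c: "\<And>W F \<phi>. finite W \<Longrightarrow> W \<noteq> {} \<Longrightarrow> \<exists>f. monotone_form f \<and> vars_of f \<subseteq> F \<and>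
      value_of f = ext_poly E (W :: nat set) F V \<phi> \<and> leaves f \<le> c * card W ^ set_treedepth E V"
    using ex_ext_poly_bform[OF treedepth_le_set_treedepth[OF fin(1)] fin(2,3)] by metis
  have "\<exists>f. monotone_form f \<and> vars_of f \<subseteq> complete_edges n \<and>
    value_of f = hom_poly V E n \<and> leaves f \<le> c * n ^ set_treedepth E V" if "n \<ge> 1" for n
    using c[of "{1..n}" "complete_edges n" undefined] that
    by (simp add: hom_poly_eq_ext_poly[OF assms])
  then show ?thesis by blast
qed

text \<open>A walk from a vertex to a different one has a first edge. A single vertex has no edge,
  and its homomorphism polynomial is the constant n, given by one source.\<close>

lemma connected_graph_cover:
  assumes "simple_graph V E" "connected_graph V E" "card V \<ge> 2"
  shows "\<Union>E = V"
proof
  show "\<Union>E \<subseteq> V" using assms(1) by (auto simp: simple_graph_def)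
  show "V \<subseteq> \<Union>E"
  proof
    fix i assume i: "i \<in> V"
    have "V \<noteq> {i}" using assms(3) by auto
    then obtain v where v: "v \<in> V" "v \<noteq> i" using i by blast
    then have "(i, v) \<in> (adj V E)\<^sup>*" using assms(2) i by (simp add: connected_graph_def)
    then show "i \<in> \<Union>E"
      by (cases rule: converse_rtranclE) (use v in \<open>auto simp: adj_def\<close>)
  qed
qed

text \<open>A map that respects the disjoint classes is injective, hence a homomorphism into the
  complete graph, so its monomial occurs in f.\<close>

lemma hom_poly_leaves_lower:
  assumes E: "simple_graph {1..k} E" "\<Union>E = {1..k}" and "k \<ge> 1" "n \<ge> k"
    and f: "monotone_form f" "value_of f = hom_poly {1..k} E n"
  shows "(n div k) ^ set_treedepth E {1..k} \<le> leaves f * (2 ^ card E) ^ card E"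
proof -
  define m where "m = n div k"
  \<comment> \<open>Vertex i receives the i-th block of m consecutive numbers. Half-open intervals
    make the blocks disjoint and of size exactly m, and k of them fit into 1..n.\<close>
  define D where "D i = {(i - 1) * m<..i * m}" for i
  have m: "m > 0" "k * m \<le> n" using assms(3,4) by (simp_all add: m_def div_greater_zero_iff)
  have finE: "finite E" using E(2) finite_UnionD by (metis finite_atLeastAtMost)
  interpret coloured_graph "{1..k}" E D m
  proof
    show "card (D i) = m" if "i \<in> {1..k}" for i
      using that by (cases i) (auto simp: D_def)
    fix i j assume ij: "i \<in> {1..k}" "j \<in> {1..k}" "D i \<inter> D j \<noteq> {}"
    then obtain x where "x \<in> D i" "x \<in> D j" by blast
    then have x: "(i - 1) * m < x" "x \<le> i * m" "(j - 1) * m < x" "x \<le> j * m"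
      by (simp_all add: D_def)
    have "\<not> i < j" using x(2,3) mult_le_mono1[of i "j - 1" m] by linarith
    moreover have "\<not> j < i" using x(1,4) mult_le_mono1[of j "i - 1" m] by linarith
    ultimately show "i = j" by linarith
  qed (use E m in auto)
  have mono: "monomials f = image_mono E ` graph_homs {1..k} E {1..n} (complete_edges n)"
    using monomials_hom_poly[OF _ finE f] by (simp add: image_mono_def)
  have D_sub: "D i \<subseteq> {1..n}" if "i \<in> {1..k}" for i
  proof -
    have "i * m \<le> k * m" using that by (intro mult_le_mono1) simp
    then have "i * m \<le> n" using m(2) by (rule le_trans)
    then show ?thesis by (auto simp: D_def)
  qed
  have "image_mono E \<phi> \<in> monomials f" if \<phi>: "\<phi> \<in> PiE {1..k} D" for \<phi>
  proof -
    have mem: "\<phi> i \<in> {1..n}" if "i \<in> {1..k}" for i using PiE_mem[OF \<phi> that] D_sub[OF that] by blast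
    have "{\<phi> i, \<phi> j} \<in> complete_edges n" if e: "{i, j} \<in> E" for i j
    proof -
      have ij: "i \<in> {1..k}" "j \<in> {1..k}" using E(2) e by blast+
      have "i \<noteq> j" using card_edge[OF e] by auto
      then have "\<phi> i \<noteq> \<phi> j"
        using disjoint_D[OF ij] PiE_mem[OF \<phi> ij(1)] PiE_mem[OF \<phi> ij(2)]
        by (metis IntI empty_iff)
      then show ?thesis unfolding complete_edges_def using mem[OF ij(1)] mem[OF ij(2)] by blast
    qed
    moreover have "\<phi> \<in> {1..k} \<rightarrow>\<^sub>E {1..n}"
      using \<phi> mem by (auto simp: PiE_iff)
    ultimately show ?thesis unfolding mono graph_homs_def by blast
  qed
  then show ?thesis
    unfolding m_def[symmetric] using mono by (intro power_treedepth_le_leaves) auto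
qed

theorem theorem3:
  fixes k :: nat and E :: "nat set set"
  assumes "k \<ge> 2"
    and "simple_graph {1..k} E"
    and "connected_graph {1..k} E"
  shows "(\<lambda>n. real (min_monotone_formula_size (complete_edges n) (hom_poly {1..k} E n)))
           \<in> \<Theta>(\<lambda>n. real n ^ treedepth {1..k} E)"
proof -
  define d where "d = treedepth {1..k} E"
  define s where "s n = min_monotone_formula_size (complete_edges n) (hom_poly {1..k} E n)" for n
  define K :: nat where "K = (2 ^ card E) ^ card E"
  have d: "set_treedepth E {1..k} = d"
    using treedepth_eq_set_treedepth[OF _ assms(3)] by (simp add: d_def)
  have d_pos: "d > 0" using set_treedepth_pos[of "{1..k}" E] assms(1) d by simp
  have cover: "\<Union>E = {1..k}" using connected_graph_cover[OF assms(2,3)] assms(1) by simp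
  obtain c where c: "\<And>n. n \<ge> 1 \<Longrightarrow> \<exists>f. monotone_form f \<and> vars_of f \<subseteq> complete_edges n \<and>
      value_of f = hom_poly {1..k} E n \<and> leaves f \<le> c * n ^ d"
    using ex_hom_poly_bform[OF assms(2)] unfolding d by blast
  have upper: "s n \<le> 2 * c * n ^ d" if "n \<ge> 1" for n
  proof -
    obtain f where f: "monotone_form f" "vars_of f \<subseteq> complete_edges n"
      "value_of f = hom_poly {1..k} E n" "leaves f \<le> c * n ^ d" using c[OF \<open>n \<ge> 1\<close>] by blast
    then show ?thesis using min_size_le_leaves[OF f(1,2)] by (simp add: s_def)
  qed
  \<comment> \<open>The 1 added to \<open>s n\<close> is the gap between leaves and edges.\<close>
  have lower: "(n div k) ^ d \<le> (s n + 1) * K" if n: "n \<ge> k" for n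
  proof -
    have "n \<ge> 1" using n assms(1) by simp
    then obtain f where f: "monotone_form f" "vars_of f \<subseteq> complete_edges n"
      "value_of f = hom_poly {1..k} E n" using c by blast
    obtain g where g: "monotone_form g" "value_of g = hom_poly {1..k} E n" "leaves g \<le> s n + 1"
      using leaves_le_min_size[OF f(1,2)] f(3) by (auto simp: s_def)
    have "(n div k) ^ d \<le> leaves g * K"
      using hom_poly_leaves_lower[OF assms(2) cover _ n g(1,2)] assms(1) unfolding d K_def by simp
    also have "\<dots> \<le> (s n + 1) * K" using g(3) by (rule mult_le_mono1)
    finally show ?thesis .
  qed
  \<comment> \<open>The threshold makes \<open>n div k\<close> exceed K. If \<open>s n\<close> were
    0, then \<open>lower\<close> would bound \<open>(n div k) ^ d\<close> by K, which fails as d >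
    0. Hence \<open>s n + 1\<close> is at most \<open>2 * s n\<close>, which is the factor 2 beside
    K.\<close>
  have lower': "n ^ d \<le> (2 * k) ^ d * K * 2 * s n" if n: "n \<ge> k * (K + 1)" for n
  proof -
    let ?m = "n div k"
    have k: "k > 0" "k \<le> n" using assms(1) n by (auto intro: le_trans[rotated])
    have m: "?m \<ge> K + 1" using n k by (simp add: less_eq_div_iff_mult_less_eq mult.commute)
    have "s n \<noteq> 0"
    proof
      assume "s n = 0"
      with lower[OF k(2)] have "?m ^ d \<le> K" by simp
      moreover have "?m ^ 1 \<le> ?m ^ d" using d_pos m by (intro power_increasing) auto
      ultimately show False using m by simp
    qed
    \<comment> \<open>Rounding in \<open>n div k\<close> costs at most a factor 2 because the
      quotient is at least 1.\<close>
    have "n < k * (?m + 1)" using k(1) dividend_less_times_div[of k n] by simp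
    also have "\<dots> \<le> 2 * k * ?m" using m by (cases ?m) auto
    finally have "n ^ d \<le> (2 * k * ?m) ^ d" by (intro power_mono) auto
    also have "\<dots> = (2 * k) ^ d * ?m ^ d" by (rule power_mult_distrib)
    also have "\<dots> \<le> (2 * k) ^ d * ((s n + 1) * K)" using lower[OF k(2)] by (rule mult_le_mono2)
    also have "\<dots> \<le> (2 * k) ^ d * ((2 * s n) * K)"
      using \<open>s n \<noteq> 0\<close> by (intro mult_le_mono2 mult_le_mono1) simp
    finally show ?thesis by (simp add: mult_ac)
  qed
  have "(\<lambda>n. real (s n)) \<in> O(\<lambda>n. real n ^ d)"
  proof (rule bigoI[where c = "real (2 * c)"], rule eventually_mono[OF eventually_ge_at_top[of 1]])
    fix n :: nat assume "1 \<le> n"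
    from upper[OF this] have "real (s n) \<le> real (2 * c * n ^ d)" by (simp only: of_nat_le_iff)
    then show "norm (real (s n)) \<le> real (2 * c) * norm (real n ^ d)" by simp
  qed
  moreover have "(\<lambda>n. real n ^ d) \<in> O(\<lambda>n. real (s n))"
  proof (rule bigoI[where c = "real ((2 * k) ^ d * K * 2)"],
      rule eventually_mono[OF eventually_ge_at_top[of "k * (K + 1)"]])
    fix n :: nat assume "k * (K + 1) \<le> n"
    from lower'[OF this] have "real (n ^ d) \<le> real ((2 * k) ^ d * K * 2 * s n)"
      by (simp only: of_nat_le_iff)
    then show "norm (real n ^ d) \<le> real ((2 * k) ^ d * K * 2) * norm (real (s n))" by simp
  qed
  ultimately show ?thesis
    by (auto simp: s_def d_def bigomega_iff_bigo intro!: bigthetaI)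
qed

end
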